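(* Let $V=V_0+W$, where $V_0,W$ are potentials on the half-line (continuum or discrete case) and $W$ has compact support. Then $\beta(\lambda;V)=\beta(\lambda;V_0)$ for every $\lambda\in S(V_0)$ (where $S(V)=S(V_0)$).
   Context: Continuum case: a potential is a real-valued locally integrable function $V$ on $[0,\infty)$, with equation $-\varphi''+V\varphi=\lambda\varphi$. Discrete case: a potential is a function $V:\{1,2,\dots\}\to\mathbb{R}$, with equation $\varphi(n+1)+\varphi(n-1)+V(n)\varphi(n)=\lambda\varphi(n)$ for $n\ge1$; $L^2$ means $\ell^2$. For $\theta\in\mathbb{R}$, $\varphi_{1,\theta}(\lambda,\cdot)$ is the solution with $\varphi_{1,\theta}(\lambda,0)=\sin\theta$, $\varphi_{1,\theta}'(\lambda,0)=-\cos\theta$ (discrete case: $\varphi_{1,\theta}(\lambda,0)=\sin\theta$, $\varphi_{1,\theta}(\lambda,1)=-\cos\theta$), and $\varphi_{2,\theta}:=\varphi_{1,\theta-\pi/2}$. For $L>0$, $\|f\|_L^2=\int_0^L|f(x)|^2dx$ in the continuum case, and $\|f\|_L^2=\sum_{n=1}^{[L]}|f(n)|^2+(L-[L])|f([L]+1)|^2$ in the discrete case. There is a subordinate solution at energy $\lambda\in\mathbb{R}$ if for some $\theta\in[0,\pi)$, $\lim_{L\to\infty}\|\varphi_{1,\theta}\|_L/\|\varphi_{2,\theta}\|_L=0$; this $\theta$ is unique and denoted $\theta(\lambda)$. $S(V)$ is the set of $\lambda\in\mathbb{R}$ for which there is a subordinate solution for $V$ but $\varphi_{1,\theta(\lambda)}\notin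 L^2$. It is known that $S(V_0+W)=S(V_0)$ if $W$ has compact support. For $\lambda\in S(V)$, $$\beta(\lambda;V)=\liminf_{L\to\infty}\frac{\ln\|\varphi_{1,\theta(\lambda)}\|_L}{\ln\|\varphi_{2,\theta(\lambda)}\|_L}\in[0,1].$$ *)

theory Defs
  imports "HOL-Analysis.Analysis"
begin

text \<open>
  Continuum case. Functions on the half-line are represented by functions \<open>real \<Rightarrow> real\<close>; no
  definition below looks at the values of a potential at negative arguments.
\<close>

definition cont_potential :: "(real \<Rightarrow> real) \<Rightarrow> bool" where
  "cont_potential V \<longleftrightarrow> (\<forall>R\<ge>0. V absolutely_integrable_on {0..R})"

definition cont_compact_support :: "(real \<Rightarrow> real) \<Rightarrow> bool" where
  "cont_compact_support W \<longleftrightarrow> compact (closure {x. 0 \<le> x \<and> W x \<noteq> 0})"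

text \<open>
  Since \<open>V\<close> is merely locally integrable, \<open>- \<phi>'' + V \<phi> = E \<phi>\<close> (\<open>E\<close> is the energy) is read in the usual
  Caratheodory sense: \<open>\<phi>\<close> is differentiable (one-sidedly at 0), and its derivative \<open>\<phi>'\<close> is an
  indefinite integral of \<open>(V - E) \<phi>\<close>, i.e. it is locally absolutely continuous with
  \<open>\<phi>'' = (V - E) \<phi>\<close> almost everywhere.
\<close>

definition cont_solution ::
  "(real \<Rightarrow> real) \<Rightarrow> real \<Rightarrow> (real \<Rightarrow> real) \<Rightarrow> (real \<Rightarrow> real) \<Rightarrow> bool" where
  "cont_solution V E \<phi> \<phi>' \<longleftrightarrow>
     (\<forall>x\<ge>0. (\<phi> has_real_derivative \<phi>' x) (at x within {0..})) \<and>
     (\<forall>x\<ge>0. ((\<lambda>t. (V t - E) * \<phi> t) has_integral (\<phi>' x - \<phi>' 0)) {0..x})"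

text \<open>
  The solution is unique on the half-line only, hence \<open>SOME\<close>: the irrelevant values at negative
  arguments are left open.
\<close>

definition cont_phi1 :: "(real \<Rightarrow> real) \<Rightarrow> real \<Rightarrow> real \<Rightarrow> real \<Rightarrow> real" where
  "cont_phi1 V \<theta> E =
     (SOME \<phi>. \<exists>\<phi>'. cont_solution V E \<phi> \<phi>' \<and> \<phi> 0 = sin \<theta> \<and> \<phi>' 0 = - cos \<theta>)"

definition cont_phi2 :: "(real \<Rightarrow> real) \<Rightarrow> real \<Rightarrow> real \<Rightarrow> real \<Rightarrow> real" where
  "cont_phi2 V \<theta> = cont_phi1 V (\<theta> - pi / 2)"

definition cont_norm :: "(real \<Rightarrow> real) \<Rightarrow> real \<Rightarrow> real" where
  "cont_norm f L = sqrt (integral {0..L} (\<lambda>x. \<bar>f x\<bar>\<^sup>2))"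

definition cont_L2 :: "(real \<Rightarrow> real) \<Rightarrow> bool" where
  "cont_L2 f \<longleftrightarrow> (\<lambda>x. \<bar>f x\<bar>\<^sup>2) absolutely_integrable_on {0..}"

definition cont_subordinate :: "(real \<Rightarrow> real) \<Rightarrow> real \<Rightarrow> real \<Rightarrow> bool" where
  "cont_subordinate V E \<theta> \<longleftrightarrow>
     ((\<lambda>L. cont_norm (cont_phi1 V \<theta> E) L / cont_norm (cont_phi2 V \<theta> E) L) \<longlongrightarrow> 0) at_top"

definition cont_theta :: "(real \<Rightarrow> real) \<Rightarrow> real \<Rightarrow> real" where
  "cont_theta V E = (THE \<theta>. \<theta> \<in> {0..<pi} \<and> cont_subordinate V E \<theta>)"

definition cont_S :: "(real \<Rightarrow> real) \<Rightarrow> real set" where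
  "cont_S V = {E. (\<exists>\<theta>\<in>{0..<pi}. cont_subordinate V E \<theta>) \<and>
                  \<not> cont_L2 (cont_phi1 V (cont_theta V E) E)}"

text \<open>The lower limit is taken in \<open>ereal\<close>, so that it exists unconditionally.\<close>

definition cont_beta :: "real \<Rightarrow> (real \<Rightarrow> real) \<Rightarrow> ereal" where
  "cont_beta E V = Liminf at_top (\<lambda>L. ereal
     (ln (cont_norm (cont_phi1 V (cont_theta V E) E) L) /
      ln (cont_norm (cont_phi2 V (cont_theta V E) E) L)))"

text \<open>
  Discrete case. Potentials are represented by functions \<open>nat \<Rightarrow> real\<close> whose value at 0 is never
  used; solutions do live on all of \<open>{0, 1, 2, \<dots>}\<close>.
\<close>

definition disc_compact_support :: "(nat \<Rightarrow> real) \<Rightarrow> bool" where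
  "disc_compact_support W \<longleftrightarrow> finite {n. 1 \<le> n \<and> W n \<noteq> 0}"

definition disc_solution :: "(nat \<Rightarrow> real) \<Rightarrow> real \<Rightarrow> (nat \<Rightarrow> real) \<Rightarrow> bool" where
  "disc_solution V E \<phi> \<longleftrightarrow> (\<forall>n\<ge>1. \<phi> (n + 1) + \<phi> (n - 1) + V n * \<phi> n = E * \<phi> n)"

definition disc_phi1 :: "(nat \<Rightarrow> real) \<Rightarrow> real \<Rightarrow> real \<Rightarrow> nat \<Rightarrow> real" where
  "disc_phi1 V \<theta> E = (THE \<phi>. disc_solution V E \<phi> \<and> \<phi> 0 = sin \<theta> \<and> \<phi> 1 = - cos \<theta>)"

definition disc_phi2 :: "(nat \<Rightarrow> real) \<Rightarrow> real \<Rightarrow> real \<Rightarrow> nat \<Rightarrow> real" where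
  "disc_phi2 V \<theta> = disc_phi1 V (\<theta> - pi / 2)"

definition disc_norm :: "(nat \<Rightarrow> real) \<Rightarrow> real \<Rightarrow> real" where
  "disc_norm f L =
     sqrt ((\<Sum>n = 1..nat \<lfloor>L\<rfloor>. \<bar>f n\<bar>\<^sup>2) + (L - real_of_int \<lfloor>L\<rfloor>) * \<bar>f (nat \<lfloor>L\<rfloor> + 1)\<bar>\<^sup>2)"

definition disc_L2 :: "(nat \<Rightarrow> real) \<Rightarrow> bool" where
  "disc_L2 f \<longleftrightarrow> (\<lambda>n. \<bar>f n\<bar>\<^sup>2) summable_on {1..}"

definition disc_subordinate :: "(nat \<Rightarrow> real) \<Rightarrow> real \<Rightarrow> real \<Rightarrow> bool" where
  "disc_subordinate V E \<theta> \<longleftrightarrow>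
     ((\<lambda>L. disc_norm (disc_phi1 V \<theta> E) L / disc_norm (disc_phi2 V \<theta> E) L) \<longlongrightarrow> 0) at_top"

definition disc_theta :: "(nat \<Rightarrow> real) \<Rightarrow> real \<Rightarrow> real" where
  "disc_theta V E = (THE \<theta>. \<theta> \<in> {0..<pi} \<and> disc_subordinate V E \<theta>)"

definition disc_S :: "(nat \<Rightarrow> real) \<Rightarrow> real set" where
  "disc_S V = {E. (\<exists>\<theta>\<in>{0..<pi}. disc_subordinate V E \<theta>) \<and>
                  \<not> disc_L2 (disc_phi1 V (disc_theta V E) E)}"

definition disc_beta :: "real \<Rightarrow> (nat \<Rightarrow> real) \<Rightarrow> ereal" where
  "disc_beta E V = Liminf at_top (\<lambda>L. ereal
     (ln (disc_norm (disc_phi1 V (disc_theta V E) E) L) /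
      ln (disc_norm (disc_phi2 V (disc_theta V E) E) L)))"

end

theory Submission
  imports Defs
begin

text \<open>
  Beyond the support of \<open>W\<close> the equations for \<open>V\<close> and \<open>V\<^sub>0\<close> coincide, and the map that sends a solution of one
  to the solution of the other with the same tail is an isomorphism of two-dimensional solution spaces. Changing a function on a
  bounded set changes its norms by a bounded amount. So in both problems the norms of \<open>\<phi>\<^bsub>1,\<theta>\<^esub>\<close> agree, up
  to bounded errors, with the values of one family of seminorms on the plane, taken at two
  different families of vectors. Subordinacy is a property of a line in that plane; the norm of any
  solution off the subordinate line tends to infinity, and all of them are comparable up to constant
  factors. Bounded factors do not affect a lower limit of quotients of logarithms that tend to
  infinity.
\<close>

section \<open>Families of seminorms on the plane\<close>

text \<open>The perturbation moves the angle of the subordinate solution, and phi2 is tied to that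
  angle: the tail of phi2 for V need not be a multiple of the tail of phi2 for V0. Membership in S
  and the value of beta are therefore first rewritten with an arbitrary second direction off the
  subordinate line. In that form they mention only the seminorms, and these are built from solutions
  for V0 in both problems. The bounded additive errors turn into bounded factors only where a norm
  tends to infinity; for the subordinate solution this is exactly the failure of square
  integrability. In the continuum case V is merely locally integrable, so the two-dimensional
  solution space has to be secured: existence by a fixed point, uniqueness by a Gronwall argument.
  Both rest on one estimate for the integral of k e^(4K), where K is a primitive of k.\<close>

definition crossp :: "real \<times> real \<Rightarrow> real \<times> real \<Rightarrow> real" where
  "crossp v w = fst v * snd w - snd v * fst w"

lemma crossp_decompose:
  assumes "crossp v w \<noteq> 0"
  obtains a b where "u = a *\<^sub>R v + b *\<^sub>R w" and "crossp v u = b * crossp v w"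
proof
  let ?a = "crossp u w / crossp v w" and ?b = "crossp v u / crossp v w"
  have "x * crossp v w = crossp u w * y + crossp v u * z \<Longrightarrow> x = ?a * y + ?b * z" for x y z
    using assms by (simp add: field_simps)
  note comp = this
  show "u = ?a *\<^sub>R v + ?b *\<^sub>R w"
    unfolding prod_eq_iff fst_add snd_add fst_scaleR snd_scaleR real_scaleR_def
    by (intro conjI comp) (simp_all add: crossp_def algebra_simps)
  show "crossp v u = ?b * crossp v w" using assms by simp
qed

lemma crossp_eq_0_dependent:
  assumes "crossp v w = 0"
  obtains s t where "s \<noteq> 0 \<or> t \<noteq> 0" "s * fst v + t * fst w = 0" "s * snd v + t * snd w = 0"
proof (cases "v = 0")
  case True
  then show ?thesis using that[of 1 0] by simp
next
  case v: False
  show ?thesis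
  proof (cases "fst v = 0")
    case True
    then have "snd v \<noteq> 0" using v by (auto simp: prod_eq_iff)
    then show ?thesis
      using that[of "snd w" "- snd v"] assms by (simp add: crossp_def True algebra_simps)
  next
    case False
    then show ?thesis
      using that[of "fst w" "- fst v"] assms by (simp add: crossp_def algebra_simps)
  qed
qed

text \<open>The triangle inequality for integral and sum norms at once: \<open>A\<close> and
  \<open>B\<close> play the squared norms and \<open>M\<close> the inner product of two functions.
  Cauchy-Schwarz is extracted from semidefiniteness alone.\<close>

lemma sqrt_quadratic_form_le:
  fixes A B M :: real
  assumes nonneg: "\<And>a b. 0 \<le> a\<^sup>2 * A + 2 * a * b * M + b\<^sup>2 * B"
  shows "sqrt (a\<^sup>2 * A + 2 * a * b * M + b\<^sup>2 * B) \<le> \<bar>a\<bar> * sqrt A + \<bar>b\<bar> * sqrt B"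
proof -
  have A: "0 \<le> A" and B: "0 \<le> B" using nonneg[of 1 0] nonneg[of 0 1] by auto
  have "M\<^sup>2 \<le> A * B"
  proof (cases "A = 0")
    case True
    have "M = 0"
    proof (rule ccontr)
      assume "M \<noteq> 0"
      \<comment> \<open>With A = 0 this choice makes the form equal to -1.\<close>
      then show False using nonneg[of "- (B + 1) / (2 * M)" 1] True by (simp add: field_simps)
    qed
    then show ?thesis using True by simp
  next
    case False
    \<comment> \<open>The vector (-M, A) is, up to a factor, the minimiser of the form for fixed
      b.\<close>
    have "0 \<le> A * (A * B - M\<^sup>2)"
      using nonneg[of "- M" A] by (simp add: algebra_simps power2_eq_square)
    then show ?thesis using A False by (simp add: zero_le_mult_iff)
  qed
  then have "\<bar>M\<bar> \<le> sqrt A * sqrt B"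
    by (metis real_sqrt_abs real_sqrt_le_mono real_sqrt_mult)
  then have "\<bar>a * b\<bar> * \<bar>M\<bar> \<le> \<bar>a * b\<bar> * (sqrt A * sqrt B)" by (intro mult_left_mono) auto
  moreover have "a * b * M \<le> \<bar>a * b\<bar> * \<bar>M\<bar>" by (simp flip: abs_mult)
  moreover have "(\<bar>a\<bar> * sqrt A + \<bar>b\<bar> * sqrt B)\<^sup>2 = a\<^sup>2 * A + 2 * (\<bar>a * b\<bar> * (sqrt A * sqrt B)) + b\<^sup>2 * B"
    using A B by (simp add: power2_sum power_mult_distrib abs_mult algebra_simps)
  ultimately show ?thesis
    using A B by (intro real_le_lsqrt) auto
qed

section \<open>Stability of limits and lower limits of quotients under bounded errors\<close>

lemma Liminf_ereal_cong_diff: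
  fixes f g :: "real \<Rightarrow> real"
  assumes "((\<lambda>x. f x - g x) \<longlongrightarrow> 0) F"
  shows "Liminf F (\<lambda>x. ereal (f x)) = Liminf F (\<lambda>x. ereal (g x))"
proof -
  have le: "Liminf F (\<lambda>x. ereal (f x)) \<le> Liminf F (\<lambda>x. ereal (g x))"
    if lim: "((\<lambda>x. f x - g x) \<longlongrightarrow> 0) F" for f g :: "real \<Rightarrow> real"
    unfolding le_Liminf_iff
  proof (intro allI impI)
    fix y assume y: "y < Liminf F (\<lambda>x. ereal (f x))"
    then obtain z where z: "y < z" "z < Liminf F (\<lambda>x. ereal (f x))"
      using dense by blast
    have f: "\<forall>\<^sub>F x in F. z < ereal (f x)" by (rule less_LiminfD[OF z(2)])
    show "\<forall>\<^sub>F x in F. y < ereal (g x)"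
    proof (cases y)
      case (real r)
      \<comment> \<open>A real number strictly between y and z leaves the room s - r into which f -
        g eventually fits.\<close>
      obtain s where s: "y < ereal s" "ereal s < z"
        using ereal_dense2[OF z(1)] by blast
      with real have "s - r > 0" by simp
      then have "\<forall>\<^sub>F x in F. f x - g x < s - r"
        using lim by (rule order_tendstoD(2)[rotated])
      with f show ?thesis
      proof eventually_elim
        case (elim x)
        then have "ereal s < ereal (f x)" using s(2) less_trans by blast
        then show ?case using elim(2) by (simp add: real)
      qed
    next
      case PInf
      then show ?thesis using y by simp
    next
      case MInf
      then show ?thesis by simp
    qed
  qed
  have "((\<lambda>x. g x - f x) \<longlongrightarrow> 0) F"
    using tendsto_minus[OF assms] by simp
  then show ?thesis using le assms by (intro antisym) auto
qed

text \<open>The numerator may stay bounded, so its additive error cannot be traded for a factor; it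
  disappears on division by \<open>y\<close>, which tends to infinity. In the denominator a factor
  is harmless.\<close>

lemma tendsto_0_divide_perturb:
  fixes x y x' y' :: "real \<Rightarrow> real"
  assumes lim: "((\<lambda>L. x L / y L) \<longlongrightarrow> 0) F" and y: "filterlim y at_top F"
    and x'0: "\<forall>\<^sub>F L in F. 0 \<le> x' L" and x': "\<forall>\<^sub>F L in F. x' L \<le> x L + C"
    and k: "0 < k" and y': "\<forall>\<^sub>F L in F. k * y L \<le> y' L"
  shows "((\<lambda>L. x' L / y' L) \<longlongrightarrow> 0) F"
proof (rule real_tendsto_sandwich)
  have y0: "\<forall>\<^sub>F L in F. 0 < y L" using y by (simp add: filterlim_at_top_dense)
  show "\<forall>\<^sub>F L in F. 0 \<le> x' L / y' L"
    using x'0 y' y0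
  proof eventually_elim
    case (elim L)
    have "0 \<le> k * y L" using elim(3) k by simp
    then show ?case using elim(1,2) by (intro divide_nonneg_nonneg) auto
  qed
  show "\<forall>\<^sub>F L in F. x' L / y' L \<le> (x L / y L + C / y L) / k"
    using x' x'0 y' y0
  proof eventually_elim
    case (elim L)
    have "x' L / y' L \<le> (x L + C) / (k * y L)"
      using elim k by (intro frac_le) auto
    also have "\<dots> = (x L / y L + C / y L) / k" by (simp add: add_divide_distrib mult.commute)
    finally show ?case .
  qed
  have "((\<lambda>L. C / y L) \<longlongrightarrow> 0) F"
    by (rule real_tendsto_divide_at_top[OF tendsto_const y])
  then have "((\<lambda>L. (x L / y L + C / y L) / k) \<longlongrightarrow> (0 + 0) / k) F"
    using k by (intro tendsto_intros lim) auto
  then show "((\<lambda>L. (x L / y L + C / y L) / k) \<longlongrightarrow> 0) F" by simp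
qed simp

lemma at_top_perturb:
  fixes y y' :: "real \<Rightarrow> real"
  assumes "filterlim y at_top F" "0 < k" "\<forall>\<^sub>F L in F. k * y L \<le> y' L"
  shows "filterlim y' at_top F"
  by (rule filterlim_at_top_mono[OF filterlim_tendsto_pos_mult_at_top[OF tendsto_const assms(2,1)] assms(3)])

lemma le_half_perturb:
  fixes y y' :: "real \<Rightarrow> real"
  assumes y: "filterlim y at_top F" and "\<forall>\<^sub>F L in F. y L - C \<le> y' L"
  shows "\<forall>\<^sub>F L in F. 1/2 * y L \<le> y' L"
proof -
  have "\<forall>\<^sub>F L in F. 2 * C \<le> y L" using y by (simp add: filterlim_at_top)
  with assms(2) show ?thesis by eventually_elim simp
qed

lemma ln_perturb:
  assumes "0 < k" "0 < K" "0 < (a::real)" "k * a \<le> b" "b \<le> K * a"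
  shows "\<bar>ln b - ln a\<bar> \<le> \<bar>ln k\<bar> + \<bar>ln K\<bar>"
proof -
  have b: "0 < b" using assms by (smt (verit) mult_pos_pos)
  have "ln (k * a) \<le> ln b" "ln b \<le> ln (K * a)" using assms b by auto
  then show ?thesis using assms by (simp add: ln_mult)
qed

text \<open>Bounded factors shift both logarithms by bounded amounts, and the two quotients then
  differ by O(1 / ln y). The assumption x \<le> y keeps ln x / ln y bounded, so that the shift of
  the denominator also has only this effect.\<close>

lemma Liminf_ln_ratio_cong:
  fixes x y x' y' :: "real \<Rightarrow> real"
  assumes x: "filterlim x at_top F" and y: "filterlim y at_top F"
    and xy: "\<forall>\<^sub>F L in F. x L \<le> y L"
    and k: "0 < k" "0 < K" "\<forall>\<^sub>F L in F. k * x L \<le> x' L \<and> x' L \<le> K * x L"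
    and l: "0 < l" "0 < M" "\<forall>\<^sub>F L in F. l * y L \<le> y' L \<and> y' L \<le> M * y L"
  shows "Liminf F (\<lambda>L. ereal (ln (x L) / ln (y L))) = Liminf F (\<lambda>L. ereal (ln (x' L) / ln (y' L)))"
proof (rule Liminf_ereal_cong_diff)
  define A where "A = \<bar>ln k\<bar> + \<bar>ln K\<bar>"
  define B where "B = \<bar>ln l\<bar> + \<bar>ln M\<bar>"
  have lny: "filterlim (\<lambda>L. ln (y L)) at_top F"
    by (rule filterlim_compose[OF ln_at_top y])
  have x1: "\<forall>\<^sub>F L in F. 1 < x L" using x by (simp add: filterlim_at_top_dense)
  \<comment> \<open>Beyond this threshold a shift of ln y by at most B leaves at least half of it,
    so the perturbed denominator stays away from 0.\<close>
  have yB: "\<forall>\<^sub>F L in F. 1 + 2 * B < ln (y L)" using lny by (simp add: filterlim_at_top_dense)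
  have "\<forall>\<^sub>F L in F. norm (ln (x L) / ln (y L) - ln (x' L) / ln (y' L)) \<le> (2 * (A + B)) / ln (y L)"
    using x1 yB xy k(3) l(3)
  proof eventually_elim
    case (elim L)
    define a where "a = ln (x L)"
    define b where "b = ln (y L)"
    define p where "p = ln (x' L)"
    define q where "q = ln (y' L)"
    have ab: "0 \<le> a" "a \<le> b" using elim by (auto simp: a_def b_def)
    have A: "\<bar>p - a\<bar> \<le> A"
      unfolding p_def a_def A_def by (rule ln_perturb) (use elim k in auto)
    have B: "\<bar>q - b\<bar> \<le> B"
      unfolding q_def b_def B_def by (rule ln_perturb) (use elim l in auto)
    have B0: "0 \<le> B" "0 \<le> A" by (simp_all add: B_def A_def)
    have b: "1 + 2 * B < b" using elim by (simp add: b_def)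
    have q: "b / 2 \<le> q" "0 < q" "0 < b" using B b B0 by auto
    have "a / b - p / q = (a * q - p * b) / (b * q)" using q by (simp add: field_simps)
    also have "a * q - p * b = a * (q - b) - (p - a) * b" by (simp add: algebra_simps)
    finally have eq: "\<bar>a / b - p / q\<bar> = \<bar>a * (q - b) - (p - a) * b\<bar> / (b * q)"
      using q by (simp add: abs_divide)
    have "\<bar>a * (q - b) - (p - a) * b\<bar> \<le> a * \<bar>q - b\<bar> + \<bar>p - a\<bar> * b"
      using ab q by (metis abs_mult abs_of_nonneg abs_of_pos abs_triangle_ineq4)
    also have "\<dots> \<le> b * B + A * b"
      using ab A B B0 q by (intro add_mono mult_mono) auto
    also have "\<dots> = b * (A + B)" by (simp add: algebra_simps)
    finally have "\<bar>a / b - p / q\<bar> \<le> b * (A + B) / (b * q)"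
      unfolding eq using q by (intro divide_right_mono) auto
    also have "\<dots> = (A + B) / q" using q by simp
    also have "\<dots> \<le> (A + B) / (b / 2)" using q B0 by (intro divide_left_mono) auto
    finally show ?case by (simp add: a_def b_def p_def q_def algebra_simps)
  qed
  moreover have "((\<lambda>L. (2 * (A + B)) / ln (y L)) \<longlongrightarrow> 0) F"
    by (rule real_tendsto_divide_at_top[OF tendsto_const lny])
  ultimately show "((\<lambda>L. ln (x L) / ln (y L) - ln (x' L) / ln (y' L)) \<longlongrightarrow> 0) F"
    by (rule Lim_null_comparison)
qed

text \<open>\<open>combine\<close> packs the triangle inequality and one half of homogeneity into
  the form that the concrete norms deliver; the other half comes from the inverse factor, see
  \<open>scale\<close>. Definiteness fails in the intended instances, where all norms vanish at L =
  0.\<close>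

locale seminorm_family =
  fixes n :: "real \<times> real \<Rightarrow> real \<Rightarrow> real"
  assumes nonneg: "0 \<le> L \<Longrightarrow> 0 \<le> n v L"
    and combine: "0 \<le> L \<Longrightarrow> n (a *\<^sub>R v + b *\<^sub>R w) L \<le> \<bar>a\<bar> * n v L + \<bar>b\<bar> * n w L"
begin

lemma scale: "n (c *\<^sub>R v) L = \<bar>c\<bar> * n v L" if "0 \<le> L"
proof -
  have le: "n (c *\<^sub>R v) L \<le> \<bar>c\<bar> * n v L" for c v
    using combine[OF that, of c v 0 0] by simp
  show ?thesis
  proof (cases "c = 0")
    case True
    then show ?thesis using le[of c v] nonneg[OF that, of "c *\<^sub>R v"] by simp
  next
    case False
    have "\<bar>c\<bar> * n v L \<le> \<bar>c\<bar> * (\<bar>1 / c\<bar> * n (c *\<^sub>R v) L)"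
      using le[of "1 / c" "c *\<^sub>R v"] False by (intro mult_left_mono) auto
    also have "\<dots> = n (c *\<^sub>R v) L" using False by (simp add: abs_divide)
    finally show ?thesis using le[of c v] by simp
  qed
qed

text \<open>Quantifying over every \<open>w\<close> off the line of \<open>v\<close> makes this a
  property of the line, free of any choice of angle or basis. Divergence of the denominator is built
  in; that it comes for free for solutions is part of \<open>subord_iff\<close>.\<close>

definition subord :: "real \<times> real \<Rightarrow> bool" where
  "subord v \<longleftrightarrow> (\<forall>w. crossp v w \<noteq> 0 \<longrightarrow>
     filterlim (n w) at_top at_top \<and> ((\<lambda>L. n v L / n w L) \<longlongrightarrow> 0) at_top)"

lemma subordD:
  assumes "subord v" "crossp v w \<noteq> 0"
  shows "filterlim (n w) at_top at_top" "((\<lambda>L. n v L / n w L) \<longlongrightarrow> 0) at_top"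
  using assms unfolding subord_def by blast+

lemma ev_nonneg: "\<forall>\<^sub>F L in at_top. 0 \<le> n v L"
  using eventually_ge_at_top[of 0] by eventually_elim (rule nonneg)

text \<open>Since v is negligible against w, the part a v is eventually at most half of b w. So all
  directions off the subordinate line grow at the same rate up to constants.\<close>

lemma dominated_combination:
  assumes w: "filterlim (n w) at_top at_top" and lim: "((\<lambda>L. n v L / n w L) \<longlongrightarrow> 0) at_top"
    and b: "b \<noteq> 0"
  shows "\<forall>\<^sub>F L in at_top. \<bar>b\<bar> / 2 * n w L \<le> n (a *\<^sub>R v + b *\<^sub>R w) L \<and>
           n (a *\<^sub>R v + b *\<^sub>R w) L \<le> 2 * \<bar>b\<bar> * n w L"
proof -
  have "((\<lambda>L. \<bar>a\<bar> * (n v L / n w L)) \<longlongrightarrow> \<bar>a\<bar> * 0) at_top"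
    by (intro tendsto_intros lim)
  then have "\<forall>\<^sub>F L in at_top. \<bar>a\<bar> * (n v L / n w L) < \<bar>b\<bar> / 2"
    using b by (intro order_tendstoD(2)) auto
  moreover have "\<forall>\<^sub>F L in at_top. 0 < n w L" using w by (simp add: filterlim_at_top_dense)
  ultimately show ?thesis using eventually_ge_at_top[of 0]
  proof eventually_elim
    case (elim L)
    have av: "\<bar>a\<bar> * n v L \<le> \<bar>b\<bar> / 2 * n w L" using elim by (simp add: field_simps)
    \<comment> \<open>Reverse triangle inequality: b w is the combination minus a v.\<close>
    have "\<bar>b\<bar> * n w L = n ((1::real) *\<^sub>R (a *\<^sub>R v + b *\<^sub>R w) + (- a) *\<^sub>R v) L"
      using scale[OF elim(3), of b w] by simp
    also have "\<dots> \<le> n (a *\<^sub>R v + b *\<^sub>R w) L + \<bar>a\<bar> * n v L"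
      using combine[OF elim(3), of 1 "a *\<^sub>R v + b *\<^sub>R w" "- a" v] by simp
    finally have "\<bar>b\<bar> / 2 * n w L \<le> n (a *\<^sub>R v + b *\<^sub>R w) L" using av by simp
    moreover have "n (a *\<^sub>R v + b *\<^sub>R w) L \<le> 2 * \<bar>b\<bar> * n w L"
    proof -
      have "0 \<le> \<bar>b\<bar> * n w L" using elim by simp
      then show ?thesis using combine[OF elim(3), of a v b w] av by simp
    qed
    ultimately show ?case ..
  qed
qed

text \<open>One direction \<open>w\<close> decides for all others: any other u off the line is a v +
  b w with b \<noteq> 0 and hence comparable to w.\<close>

lemma subordI:
  assumes vw: "crossp v w \<noteq> 0" and w: "filterlim (n w) at_top at_top"
    and lim: "((\<lambda>L. n v L / n w L) \<longlongrightarrow> 0) at_top"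
  shows "subord v"
  unfolding subord_def
proof (intro allI impI)
  fix u assume u: "crossp v u \<noteq> 0"
  obtain a b where ab: "u = a *\<^sub>R v + b *\<^sub>R w" "crossp v u = b * crossp v w"
    using crossp_decompose[OF vw] by blast
  then have b: "b \<noteq> 0" using u by auto
  have ev: "\<forall>\<^sub>F L in at_top. \<bar>b\<bar> / 2 * n w L \<le> n u L"
    using dominated_combination[OF w lim b, of a] unfolding ab(1) by eventually_elim simp
  show "filterlim (n u) at_top at_top \<and> ((\<lambda>L. n v L / n u L) \<longlongrightarrow> 0) at_top"
  proof
    show "filterlim (n u) at_top at_top"
      by (rule at_top_perturb[OF w _ ev]) (use b in simp)
    show "((\<lambda>L. n v L / n u L) \<longlongrightarrow> 0) at_top"
      by (rule tendsto_0_divide_perturb[OF lim w ev_nonneg _ _ ev, where C = 0]) (use b in auto)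
  qed
qed

lemma subord_scale: "subord v" if "subord (c *\<^sub>R v)" "c \<noteq> 0"
proof -
  have cr: "crossp (c *\<^sub>R v) w = c * crossp v w" for w
    by (simp add: crossp_def algebra_simps)
  have "((\<lambda>L. n v L / n w L) \<longlongrightarrow> 0) at_top" if "((\<lambda>L. n (c *\<^sub>R v) L / n w L) \<longlongrightarrow> 0) at_top" for w
  proof -
    have "((\<lambda>L. 1 / \<bar>c\<bar> * (n (c *\<^sub>R v) L / n w L)) \<longlongrightarrow> 1 / \<bar>c\<bar> * 0) at_top"
      by (intro tendsto_intros that)
    moreover have "\<forall>\<^sub>F L in at_top. 1 / \<bar>c\<bar> * (n (c *\<^sub>R v) L / n w L) = n v L / n w L"
      using eventually_ge_at_top[of 0] by eventually_elim (simp add: scale \<open>c \<noteq> 0\<close>)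
    ultimately show ?thesis using tendsto_cong by force
  qed
  then show ?thesis using that unfolding subord_def cr by simp
qed

text \<open>Two independent subordinate directions would dominate each other: the product of the two
  reciprocal quotients is eventually 1 and yet tends to 0. This is the uniqueness of the subordinate
  angle.\<close>

lemma subord_parallel:
  assumes v: "subord v" and w: "subord w"
  shows "crossp v w = 0"
proof (rule ccontr)
  assume vw: "crossp v w \<noteq> 0"
  then have wv: "crossp w v \<noteq> 0" by (auto simp: crossp_def algebra_simps)
  have "((\<lambda>L. (n v L / n w L) * (n w L / n v L)) \<longlongrightarrow> 0 * 0) at_top"
    by (intro tendsto_intros) (fact subordD(2)[OF v vw] subordD(2)[OF w wv])+
  moreover have "\<forall>\<^sub>F L in at_top. 0 < n v L" "\<forall>\<^sub>F L in at_top. 0 < n w L"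
    using subordD(1)[OF w wv] subordD(1)[OF v vw] by (auto simp: filterlim_at_top_dense)
  then have "\<forall>\<^sub>F L in at_top. (n v L / n w L) * (n w L / n v L) = 1"
    by eventually_elim simp
  ultimately have "((\<lambda>L::real. 1::real) \<longlongrightarrow> 0 * 0) at_top"
    by (rule Lim_transform_eventually)
  then show False by (simp add: tendsto_const_iff)
qed

end

text \<open>
  Here \<open>n v L\<close> is the norm on \<open>[0, L]\<close> of the combination, with coefficients \<open>v\<close>, of two fixed
  reference solutions, and \<open>p \<theta> L\<close> is the norm of \<open>\<phi>\<^bsub>1,\<theta>\<^esub>\<close>. For large arguments, \<open>e1\<close> and \<open>e2\<close> are the
  coordinates of \<open>\<phi>\<^bsub>1,\<pi>/2\<^esub>\<close> and \<open>\<phi>\<^bsub>1,0\<^esub>\<close> in terms of the reference solutions, which may belong to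
  another potential.
\<close>

locale norms_of_solutions = seminorm_family +
  fixes e1 e2 :: "real \<times> real" and p :: "real \<Rightarrow> real \<Rightarrow> real"
  assumes basis: "crossp e1 e2 \<noteq> 0"
    and close: "\<exists>C. \<forall>\<^sub>F L in at_top. \<bar>p t L - n (sin t *\<^sub>R e1 + cos t *\<^sub>R e2) L\<bar> \<le> C"
    and p_nonneg: "0 \<le> L \<Longrightarrow> 0 \<le> p t L"
    and p_mono: "0 \<le> L \<Longrightarrow> L \<le> M \<Longrightarrow> p t L \<le> p t M"
    and p_nonzero: "\<exists>L\<ge>0. 0 < p t L"
begin

text \<open>The initial data (sin t, - cos t) are sin t times those at angle pi/2, namely (1, 0),
  plus cos t times those at angle 0, namely (0, -1).\<close>

definition coords :: "real \<Rightarrow> real \<times> real" where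
  "coords t = sin t *\<^sub>R e1 + cos t *\<^sub>R e2"

lemma crossp_coords: "crossp (coords s) (coords t) = crossp e1 e2 * sin (s - t)"
  by (simp add: coords_def crossp_def sin_diff algebra_simps)

lemma crossp_coords_orth: "crossp (coords t) (coords (t - pi / 2)) \<noteq> 0"
  using basis by (simp add: crossp_coords)

lemma coords_cover:
  assumes "v \<noteq> 0"
  obtains c t where "c \<noteq> 0" "t \<in> {0..<pi}" "v = c *\<^sub>R coords t"
proof -
  obtain a b where ab: "v = a *\<^sub>R e1 + b *\<^sub>R e2"
    using crossp_decompose[OF basis] by blast
  define r where "r = sqrt (a\<^sup>2 + b\<^sup>2)"
  have "a\<^sup>2 + b\<^sup>2 \<noteq> 0" using ab assms by (auto simp: sum_power2_eq_zero_iff)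
  then have r: "r > 0" unfolding r_def by (simp add: less_le)
  have "(b / r)\<^sup>2 + (a / r)\<^sup>2 = 1"
    using \<open>a\<^sup>2 + b\<^sup>2 \<noteq> 0\<close>
    by (simp add: r_def power_divide add_divide_distrib[symmetric] add.commute[of "b\<^sup>2"])
  then obtain s where s: "0 \<le> s" "s < 2 * pi" "b / r = cos s" "a / r = sin s"
    using sincos_total_2pi by metis
  then have "a = r * sin s" "b = r * cos s" using r by (simp_all add: field_simps)
  then have v: "v = r *\<^sub>R coords s"
    unfolding ab coords_def by (simp add: scaleR_add_right)
  show ?thesis
  proof (cases "s < pi")
    case True
    then show ?thesis using that[of r s, OF _ _ v] r s(1) by simp
  next
    case False
    \<comment> \<open>An angle in the lower half-plane is moved back by pi, and the sign goes into
      the scalar; this is why \<open>c\<close> may be negative.\<close>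
    have "v = (- r) *\<^sub>R coords (s - pi)"
      unfolding v by (simp add: coords_def sin_diff cos_diff scaleR_diff_right scaleR_add_right)
    then show ?thesis using that[of "- r" "s - pi"] False r s(2) by simp
  qed
qed

lemma p_at_top: "filterlim (p t) at_top at_top" if "\<nexists>K. \<forall>L\<ge>0. p t L \<le> K"
  unfolding filterlim_at_top
proof
  fix Z
  have "\<not> (\<forall>L\<ge>0. p t L \<le> Z)" using that by simp
  then obtain L where L: "L \<ge> 0" "Z < p t L" by (auto simp: not_le)
  show "\<forall>\<^sub>F M in at_top. Z \<le> p t M"
    using eventually_ge_at_top[of L]
  proof eventually_elim
    case (elim M)
    then show ?case using p_mono[OF L(1) elim, of t] L(2) by linarith
  qed
qed

lemma close_coords:
  obtains C where "\<forall>\<^sub>F L in at_top. p t L \<le> n (coords t) L + C"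
    "\<forall>\<^sub>F L in at_top. n (coords t) L - C \<le> p t L"
    "\<forall>\<^sub>F L in at_top. n (coords t) L \<le> p t L + C"
    "\<forall>\<^sub>F L in at_top. p t L - C \<le> n (coords t) L"
proof -
  obtain C where C: "\<forall>\<^sub>F L in at_top. \<bar>p t L - n (coords t) L\<bar> \<le> C"
    using close by (auto simp: coords_def)
  show ?thesis
    by (rule that[of C]) (use C in \<open>eventually_elim, linarith\<close>)+
qed

lemma ev_p_nonneg: "\<forall>\<^sub>F L in at_top. 0 \<le> p t L"
  using eventually_ge_at_top[of 0] by eventually_elim (rule p_nonneg)

text \<open>For the direction from the quotient to \<open>subord\<close>, divergence of the
  denominator must be derived: the numerator is monotone and eventually bounded below by a positive
  number, so a quotient tending to 0 forces it.\<close>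

lemma subord_iff: "subord (coords t) \<longleftrightarrow> ((\<lambda>L. p t L / p (t - pi / 2) L) \<longlongrightarrow> 0) at_top"
proof
  let ?s = "t - pi / 2"
  obtain C where C: "\<forall>\<^sub>F L in at_top. p t L \<le> n (coords t) L + C"
    "\<forall>\<^sub>F L in at_top. n (coords t) L \<le> p t L + C"
    using close_coords[of t] by blast
  obtain D where D: "\<forall>\<^sub>F L in at_top. n (coords ?s) L - D \<le> p ?s L"
    "\<forall>\<^sub>F L in at_top. p ?s L - D \<le> n (coords ?s) L"
    using close_coords[of ?s] by blast
  {
    assume "subord (coords t)"
    then have w: "filterlim (n (coords ?s)) at_top at_top"
      and lim: "((\<lambda>L. n (coords t) L / n (coords ?s) L) \<longlongrightarrow> 0) at_top"
      using subordD[OF _ crossp_coords_orth] by blast+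
    show "((\<lambda>L. p t L / p ?s L) \<longlongrightarrow> 0) at_top"
      by (rule tendsto_0_divide_perturb[OF lim w ev_p_nonneg C(1) _ le_half_perturb[OF w D(1)]]) simp
  next
    assume lim: "((\<lambda>L. p t L / p ?s L) \<longlongrightarrow> 0) at_top"
    obtain L0 where L0: "L0 \<ge> 0" "0 < p t L0" using p_nonzero by blast
    \<comment> \<open>Positivity of the denominator beyond \<open>L1\<close> excludes quotients that
      are 0 merely because x / 0 = 0.\<close>
    obtain L1 where L1: "L1 \<ge> 0" "0 < p ?s L1" using p_nonzero by blast
    have w: "filterlim (p ?s) at_top at_top"
      unfolding filterlim_at_top_gt[where c = 0]
    proof (intro allI impI)
      fix Z :: real assume Z: "0 < Z"
      \<comment> \<open>The numerator is at least p t L0 from L0 on, so a quotient below p t L0 / Z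
        makes the denominator exceed Z.\<close>
      have "\<forall>\<^sub>F L in at_top. p t L / p ?s L < p t L0 / Z"
        by (rule order_tendstoD(2)[OF lim]) (use L0 Z in simp)
      then show "\<forall>\<^sub>F L in at_top. Z \<le> p ?s L"
        using eventually_ge_at_top[of L0] eventually_ge_at_top[of L1]
      proof eventually_elim
        case (elim L)
        have pt: "p t L0 \<le> p t L" and ps: "0 < p ?s L"
          using p_mono[OF L0(1) elim(2), of t] p_mono[OF L1(1) elim(3), of ?s] L1 by auto
        have "p t L0 / p ?s L \<le> p t L / p ?s L" using pt ps by (simp add: divide_right_mono)
        then have "p t L0 / p ?s L < p t L0 / Z" using elim(1) by simp
        then show ?case using L0(2) ps Z by (simp add: field_simps)
      qed
    qed
    have ev: "\<forall>\<^sub>F L in at_top. 1/2 * p ?s L \<le> n (coords ?s) L" by (rule le_half_perturb[OF w D(2)])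
    show "subord (coords t)"
    proof (rule subordI[OF crossp_coords_orth])
      show "filterlim (n (coords ?s)) at_top at_top" by (rule at_top_perturb[OF w _ ev]) simp
      show "((\<lambda>L. n (coords t) L / n (coords ?s) L) \<longlongrightarrow> 0) at_top"
        by (rule tendsto_0_divide_perturb[OF lim w ev_nonneg C(2) _ ev]) simp
    qed
  }
qed

text \<open>This and the next two definitions mirror the given notions for both cases, with square
  integrability replaced by boundedness of the norms. They depend on \<open>p\<close> alone, so
  outside the locale \<open>p\<close> is their only argument and two problems can be
  compared.\<close>

definition theta :: real where
  "theta = (THE t. t \<in> {0..<pi} \<and> ((\<lambda>L. p t L / p (t - pi / 2) L) \<longlongrightarrow> 0) at_top)"

definition S_cond :: bool where
  "S_cond \<longleftrightarrow> (\<exists>t\<in>{0..<pi}. ((\<lambda>L. p t L / p (t - pi / 2) L) \<longlongrightarrow> 0) at_top) \<and>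
     \<not> (\<exists>K. \<forall>L\<ge>0. p theta L \<le> K)"

definition beta :: ereal where
  "beta = Liminf at_top (\<lambda>L. ereal (ln (p theta L) / ln (p (theta - pi / 2) L)))"

lemma theta_eq:
  assumes "t \<in> {0..<pi}" "subord (coords t)"
  shows "theta = t"
  unfolding theta_def subord_iff[symmetric]
proof (rule the_equality)
  show "t \<in> {0..<pi} \<and> subord (coords t)" using assms by simp
next
  fix s assume s: "s \<in> {0..<pi} \<and> subord (coords s)"
  then have "sin (s - t) = 0"
    using subord_parallel[of "coords s" "coords t"] assms basis by (simp add: crossp_coords)
  then show "s = t"
    using sin_gt_zero[of "s - t"] sin_gt_zero[of "t - s"] s assms(1) sin_minus[of "s - t"]
    by (cases s t rule: linorder_cases) auto
qed

lemma ev_bounds: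
  assumes "filterlim (n (coords t)) at_top at_top"
  shows "\<forall>\<^sub>F L in at_top. 1/2 * n (coords t) L \<le> p t L \<and> p t L \<le> 2 * n (coords t) L"
proof -
  obtain C where C: "\<forall>\<^sub>F L in at_top. p t L \<le> n (coords t) L + C"
    "\<forall>\<^sub>F L in at_top. n (coords t) L - C \<le> p t L"
    using close_coords[of t] by blast
  have "\<forall>\<^sub>F L in at_top. C \<le> n (coords t) L" using assms by (simp add: filterlim_at_top)
  with le_half_perturb[OF assms C(2)] C(1) show ?thesis by eventually_elim simp
qed

text \<open>The right-hand side does not mention \<open>p\<close>, \<open>e1\<close> or
  \<open>e2\<close>: any vector on the subordinate line and any vector off it give the same lower
  limit. This is what makes beta transferable.\<close>

lemma beta_eq:
  assumes v: "subord v" and top: "filterlim (n v) at_top at_top" and vw: "crossp v w \<noteq> 0"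
    and t: "t \<in> {0..<pi}" and c: "c \<noteq> 0" "v = c *\<^sub>R coords t"
  shows "beta = Liminf at_top (\<lambda>L. ereal (ln (n v L) / ln (n w L)))"
proof -
  let ?s = "t - pi / 2"
  have sub: "subord (coords t)" using subord_scale[of c "coords t"] v c by simp
  have th: "theta = t" by (rule theta_eq[OF t sub])
  have w: "filterlim (n w) at_top at_top" and lim: "((\<lambda>L. n v L / n w L) \<longlongrightarrow> 0) at_top"
    using subordD[OF v vw] by blast+
  have w0: "\<forall>\<^sub>F L in at_top. 0 < n w L" using w by (simp add: filterlim_at_top_dense)
  have "\<forall>\<^sub>F L in at_top. n v L / n w L < 1" by (rule order_tendstoD(2)[OF lim]) simp
  then have le: "\<forall>\<^sub>F L in at_top. n v L \<le> n w L"
    using w0 by eventually_elim simp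
  have cv: "coords t = (1 / c) *\<^sub>R v" using c by simp
  have nv: "\<forall>\<^sub>F L in at_top. n (coords t) L = 1 / \<bar>c\<bar> * n v L"
    using eventually_ge_at_top[of 0] by eventually_elim (simp add: cv scale)
  have "\<forall>\<^sub>F L in at_top. 1 / \<bar>c\<bar> * n v L \<le> n (coords t) L"
    using nv by eventually_elim simp
  then have "filterlim (n (coords t)) at_top at_top"
    by (rule at_top_perturb[OF top, rotated]) (use c in simp)
  from ev_bounds[OF this] nv
  have x: "\<forall>\<^sub>F L in at_top. (1/2 * (1 / \<bar>c\<bar>)) * n v L \<le> p t L \<and> p t L \<le> (2 * (1 / \<bar>c\<bar>)) * n v L"
    by eventually_elim simp
  \<comment> \<open>The second solution has some component along v, which is dominated; what matters
    is that its component b along w is nonzero.\<close>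
  obtain a b where ab: "coords ?s = a *\<^sub>R v + b *\<^sub>R w" "crossp v (coords ?s) = b * crossp v w"
    using crossp_decompose[OF vw] by blast
  have "crossp v (coords ?s) = c * crossp (coords t) (coords ?s)"
    by (simp add: c(2) crossp_def algebra_simps)
  then have b: "b \<noteq> 0" using ab(2) c(1) crossp_coords_orth by auto
  note dom = dominated_combination[OF w lim b, of a, folded ab(1)]
  have "filterlim (n (coords ?s)) at_top at_top"
    by (rule subordD(1)[OF sub crossp_coords_orth])
  from ev_bounds[OF this] dom
  have y: "\<forall>\<^sub>F L in at_top. (1/2 * (\<bar>b\<bar> / 2)) * n w L \<le> p ?s L \<and> p ?s L \<le> (2 * (2 * \<bar>b\<bar>)) * n w L"
    by eventually_elim simp
  show ?thesis
    unfolding beta_def th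
    by (rule Liminf_ln_ratio_cong[OF top w le _ _ x _ _ y, symmetric]) (use b c in auto)
qed

text \<open>As in \<open>beta_eq\<close>, the purpose is a right-hand side that depends on the
  seminorms only and is thus common to both potentials.\<close>

lemma S_cond_iff: "S_cond \<longleftrightarrow> (\<exists>v. v \<noteq> 0 \<and> subord v \<and> filterlim (n v) at_top at_top)"
proof
  assume S: S_cond
  then obtain t where t: "t \<in> {0..<pi}" "subord (coords t)"
    by (auto simp: S_cond_def subord_iff)
  have "filterlim (p t) at_top at_top"
    using S p_at_top[of t] by (simp add: S_cond_def theta_eq[OF t])
  moreover obtain C where "\<forall>\<^sub>F L in at_top. p t L - C \<le> n (coords t) L"
    using close_coords[of t] by blast
  ultimately have "filterlim (n (coords t)) at_top at_top"
    using at_top_perturb[OF _ _ le_half_perturb, of "p t" at_top C "n (coords t)"] by simp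
  moreover have "coords t \<noteq> 0" using crossp_coords_orth[of t] by (auto simp: crossp_def)
  ultimately show "\<exists>v. v \<noteq> 0 \<and> subord v \<and> filterlim (n v) at_top at_top" using t by blast
next
  assume "\<exists>v. v \<noteq> 0 \<and> subord v \<and> filterlim (n v) at_top at_top"
  then obtain v where v: "v \<noteq> 0" "subord v" "filterlim (n v) at_top at_top" by blast
  obtain c t where ct: "c \<noteq> 0" "t \<in> {0..<pi}" "v = c *\<^sub>R coords t" using coords_cover[OF v(1)] by blast
  have sub: "subord (coords t)" using subord_scale[of c "coords t"] v ct by simp
  have th: "theta = t" by (rule theta_eq[OF ct(2) sub])
  obtain C where C: "\<forall>\<^sub>F L in at_top. n (coords t) L \<le> p t L + C"
    using close_coords[of t] by blast
  have "\<not> (\<exists>K. \<forall>L\<ge>0. p t L \<le> K)"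
  proof
    assume "\<exists>K. \<forall>L\<ge>0. p t L \<le> K"
    then obtain K where K: "\<And>L. L \<ge> 0 \<Longrightarrow> p t L \<le> K" by blast
    have "\<forall>\<^sub>F L in at_top. \<bar>c\<bar> * (K + C) < n v L" using v(3) by (simp add: filterlim_at_top_dense)
    with C eventually_ge_at_top[of 0] have "\<forall>\<^sub>F L::real in at_top. False"
    proof eventually_elim
      case (elim L)
      have "n v L = \<bar>c\<bar> * n (coords t) L" using elim by (simp add: ct(3) scale)
      also have "\<dots> \<le> \<bar>c\<bar> * (K + C)" using elim K[of L] by (intro mult_left_mono) auto
      finally show ?case using elim by simp
    qed
    then show False by simp
  qed
  then show S_cond using ct(2) sub by (auto simp: S_cond_def th subord_iff)
qed

end

lemma S_beta_transfer:
  assumes "norms_of_solutions n e1 e2 p" "norms_of_solutions n f1 f2 q"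
  shows "norms_of_solutions.S_cond p \<longleftrightarrow> norms_of_solutions.S_cond q"
    and "norms_of_solutions.S_cond q \<Longrightarrow> norms_of_solutions.beta p = norms_of_solutions.beta q"
proof -
  interpret P: norms_of_solutions n e1 e2 p by fact
  interpret Q: norms_of_solutions n f1 f2 q by fact
  show "P.S_cond \<longleftrightarrow> Q.S_cond" by (simp add: P.S_cond_iff Q.S_cond_iff)
  assume "Q.S_cond"
  then obtain v where v: "v \<noteq> 0" "P.subord v" "filterlim (n v) at_top at_top"
    by (auto simp: Q.S_cond_iff)
  obtain w where w: "crossp v w \<noteq> 0"
  proof
    \<comment> \<open>A quarter turn of v; the determinant is the squared length of v.\<close>
    show "crossp v (- snd v, fst v) \<noteq> 0"
      using v(1) by (cases v) (auto simp: crossp_def zero_prod_def sum_squares_eq_zero_iff)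
  qed
  obtain c t where "c \<noteq> 0" "t \<in> {0..<pi}" "v = c *\<^sub>R P.coords t" using P.coords_cover[OF v(1)] by blast
  moreover obtain d s where "d \<noteq> 0" "s \<in> {0..<pi}" "v = d *\<^sub>R Q.coords s"
    using Q.coords_cover[OF v(1)] by blast
  ultimately show "P.beta = Q.beta"
    using P.beta_eq[OF v(2,3) w] Q.beta_eq[OF v(2,3) w] by simp
qed

section \<open>Linear equations with locally integrable coefficients\<close>

text \<open>
  A substitute for the substitution \<open>s = K x\<close> in \<open>\<integral> k e\<^sup>4\<^sup>K\<close>, which would need a chain rule for
  absolutely continuous functions: going down from \<open>x\<close> in steps on which \<open>K\<close> drops by \<open>1/4\<close>, the
  pieces of the integral are dominated by a geometric series.
\<close>

lemma integral_exp_primitive_le: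
  fixes k :: "real \<Rightarrow> real"
  assumes k: "k integrable_on {a..b}" and k0: "\<And>t. t \<in> {a..b} \<Longrightarrow> 0 \<le> k t"
    and int: "(\<lambda>t. k t * exp (4 * integral {a..t} k)) integrable_on {a..b}"
    and x: "x \<in> {a..b}"
  shows "integral {a..x} (\<lambda>t. k t * exp (4 * integral {a..t} k)) \<le> exp (4 * integral {a..x} k) / 2"
proof -
  define K where "K x = integral {a..x} k" for x
  define G where "G x = integral {a..x} (\<lambda>t. k t * exp (4 * K t))" for x
  have int': "(\<lambda>t. k t * exp (4 * K t)) integrable_on {c..d}" if "a \<le> c" "d \<le> b" for c d
    using int unfolding K_def by (rule integrable_on_subinterval) (use that in auto)
  have kint: "k integrable_on {c..d}" if "a \<le> c" "d \<le> b" for c d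
    using k by (rule integrable_on_subinterval) (use that in auto)
  have Kadd: "K d - K c = integral {c..d} k" if "a \<le> c" "c \<le> d" "d \<le> b" for c d
    using Henstock_Kurzweil_Integration.integral_combine[of a c d k] that kint[of a d] by (simp add: K_def)
  have Kmono: "K c \<le> K d" if "a \<le> c" "c \<le> d" "d \<le> b" for c d
    using Kadd[OF that] integral_nonneg[OF kint[of c d]] k0 that by force
  have Kcont: "continuous_on {a..b} K"
    unfolding K_def by (rule indefinite_integral_continuous_1[OF k])
  have Ka: "K a = 0" by (simp add: K_def)
  \<comment> \<open>K is increasing, so the exponential is replaced by its value at the right end.
    Where K grows by at most 1/4 this loses at most the factor e.\<close>
  have step: "G d - G c \<le> (K d - K c) * exp (4 * K d)" if cd: "a \<le> c" "c \<le> d" "d \<le> b" for c d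
  proof -
    have "G d - G c = integral {c..d} (\<lambda>t. k t * exp (4 * K t))"
      using Henstock_Kurzweil_Integration.integral_combine[of a c d "\<lambda>t. k t * exp (4 * K t)"] cd int'[of a d] by (simp add: G_def)
    also have "\<dots> \<le> integral {c..d} (\<lambda>t. k t * exp (4 * K d))"
    proof (rule integral_le)
      show "(\<lambda>t. k t * exp (4 * K d)) integrable_on {c..d}"
        by (intro integrable_on_mult_left kint cd)
    qed (use cd k0 Kmono in \<open>auto intro!: int' mult_left_mono\<close>)
    also have "\<dots> = (K d - K c) * exp (4 * K d)"
      using Kadd[OF cd] by simp
    finally show ?thesis .
  qed
  \<comment> \<open>Induction on the number of quarter steps needed to exhaust K. The chain rule
    would give the value (e^(4K) - 1) / 4; the claimed 1/2 leaves room for the loss in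
    \<open>step\<close>.\<close>
  have "\<forall>x\<in>{a..b}. K x \<le> real m / 4 \<longrightarrow> G x \<le> exp (4 * K x) / 2" for m
  proof (induction m)
    case 0
    show ?case
    proof (intro ballI impI)
      fix x assume x: "x \<in> {a..b}" "K x \<le> real 0 / 4"
      then have "K x = 0" using Kmono[of a x] Ka by simp
      then show "G x \<le> exp (4 * K x) / 2" using step[of a x] x Ka by (simp add: G_def)
    qed
  next
    case (Suc m)
    show ?case
    proof (intro ballI impI)
      fix x assume x: "x \<in> {a..b}" "K x \<le> real (Suc m) / 4"
      show "G x \<le> exp (4 * K x) / 2"
      proof (cases "K x \<le> 1/4")
        case True
        have "G x \<le> K x * exp (4 * K x)" using step[of a x] x Ka by (simp add: G_def)
        also have "\<dots> \<le> 1/2 * exp (4 * K x)" using True by (intro mult_right_mono) auto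
        finally show ?thesis by simp
      next
        case False
        \<comment> \<open>The constants close up: lowering K by 1/4 gains the factor 1/e \<le> 1/2,
          so the part up to y contributes at most e^(4K) / 4, and so does the piece from y to
          x.\<close>
        obtain y where y: "a \<le> y" "y \<le> x" "K y = K x - 1/4"
          using IVT'[of K a "K x - 1/4" x] False x Ka continuous_on_subset[OF Kcont, of "{a..x}"] by auto
        have "G y \<le> exp (4 * K y) / 2" using Suc x y by (auto simp: field_simps)
        also have "4 * K y = 4 * K x - 1" using y by simp
        also have "exp (4 * K x - 1) / 2 \<le> exp (4 * K x) / 4"
        proof -
          have "exp (4 * K x - 1) * 2 \<le> exp (4 * K x - 1) * exp 1"
            using exp_ge_add_one_self[of 1] by (intro mult_left_mono) auto
          then show ?thesis by (simp flip: exp_add)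
        qed
        finally have "G y \<le> exp (4 * K x) / 4" .
        moreover have "G x - G y \<le> 1/4 * exp (4 * K x)" using step[of y x] x y by simp
        ultimately show ?thesis by simp
      qed
    qed
  qed
  moreover obtain m :: nat where "4 * K x \<le> real m" using real_arch_simple by blast
  ultimately have "G x \<le> exp (4 * K x) / 2" using x by (metis (no_types) le_divide_eq_numeral1(1) mult.commute)
  then show ?thesis by (simp add: G_def K_def)
qed

section \<open>Products with continuous functions, and uniqueness by Gronwall\<close>

lemma absolutely_integrable_mult_continuous:
  fixes f g :: "real \<Rightarrow> real"
  assumes f: "f absolutely_integrable_on {a..b}" and g: "continuous_on {a..b} g"
  shows "(\<lambda>x. f x * g x) absolutely_integrable_on {a..b}"
proof -
  have "(\<lambda>x. g x * f x) absolutely_integrable_on {a..b}"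
    by (rule absolutely_integrable_bounded_measurable_product_real)
       (use f g in \<open>auto intro!: continuous_imp_measurable_on_sets_lebesgue compact_imp_bounded
          compact_continuous_image\<close>)
  then show ?thesis by (simp add: mult.commute)
qed

text \<open>Let M be the maximum of m e^(-4K), attained at z. Then m \<le> M e^(4K), and inserting
  this into the hypothesis at z gives m z \<le> m z / 2, so M = 0.\<close>

lemma gronwall_zero:
  fixes k m :: "real \<Rightarrow> real"
  assumes k: "k absolutely_integrable_on {a..b}" and k0: "\<And>t. t \<in> {a..b} \<Longrightarrow> 0 \<le> k t"
    and m: "continuous_on {a..b} m" and m0: "\<And>t. t \<in> {a..b} \<Longrightarrow> 0 \<le> m t"
    and le: "\<And>x. x \<in> {a..b} \<Longrightarrow> m x \<le> integral {a..x} (\<lambda>t. k t * m t)"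
    and x: "x \<in> {a..b}"
  shows "m x = 0"
proof -
  define K where "K x = integral {a..x} k" for x
  have kint: "k integrable_on {a..b}" using k by (rule set_lebesgue_integral_eq_integral(1))
  have Kcont: "continuous_on {a..b} K"
    unfolding K_def by (rule indefinite_integral_continuous_1[OF kint])
  have int: "(\<lambda>t. k t * exp (4 * K t)) absolutely_integrable_on {a..b}"
    by (intro absolutely_integrable_mult_continuous k continuous_intros Kcont)
  have kexp: "(\<lambda>t. k t * exp (4 * K t)) integrable_on {a..y}"
    and km: "(\<lambda>t. k t * m t) integrable_on {a..y}" if "y \<in> {a..b}" for y
    using int[THEN set_lebesgue_integral_eq_integral(1)]
      absolutely_integrable_mult_continuous[OF k m, THEN set_lebesgue_integral_eq_integral(1)] that
    by (auto intro: integrable_on_subinterval)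
  have "continuous_on {a..b} (\<lambda>x. m x * exp (- (4 * K x)))"
    by (intro continuous_intros m Kcont)
  then obtain z where z: "z \<in> {a..b}"
    and max: "\<And>t. t \<in> {a..b} \<Longrightarrow> m t * exp (- (4 * K t)) \<le> m z * exp (- (4 * K z))"
    using continuous_attains_sup[of "{a..b}" "\<lambda>x. m x * exp (- (4 * K x))"] x by auto
  define M where "M = m z * exp (- (4 * K z))"
  have bound: "m t \<le> M * exp (4 * K t)" if "t \<in> {a..b}" for t
    using mult_right_mono[OF max[OF that], of "exp (4 * K t)"] by (simp add: M_def mult.assoc flip: exp_add)
  have M0: "0 \<le> M" using m0[OF z] by (simp add: M_def)
  have "m z \<le> integral {a..z} (\<lambda>t. k t * m t)" by (rule le[OF z])
  also have "\<dots> \<le> integral {a..z} (\<lambda>t. M * (k t * exp (4 * K t)))"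
  proof (rule integral_le[OF km[OF z] integrable_on_mult_right[OF kexp[OF z]]])
    fix t assume "t \<in> {a..z}"
    then have t: "t \<in> {a..b}" using z by simp
    show "k t * m t \<le> M * (k t * exp (4 * K t))"
      using mult_left_mono[OF bound[OF t] k0[OF t]] by (simp add: algebra_simps)
  qed
  also have "\<dots> = M * integral {a..z} (\<lambda>t. k t * exp (4 * K t))" by simp
  also have "\<dots> \<le> M * (exp (4 * K z) / 2)"
    unfolding K_def using kint k0 int[THEN set_lebesgue_integral_eq_integral(1)] z M0
    by (intro mult_left_mono integral_exp_primitive_le[where b = b]) (auto simp: K_def)
  also have "\<dots> = m z / 2" by (simp add: M_def exp_minus)
  finally have "M = 0" using m0[OF z] by (simp add: M_def)
  then show ?thesis using bound[OF x] m0[OF x] by simp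
qed

text \<open>Reflection t -> -t of the forward version. It serves to carry vanishing data at the edge
  of the support back to 0.\<close>

lemma gronwall_zero_backward:
  fixes k m :: "real \<Rightarrow> real"
  assumes k: "k absolutely_integrable_on {a..b}" and k0: "\<And>t. t \<in> {a..b} \<Longrightarrow> 0 \<le> k t"
    and m: "continuous_on {a..b} m" and m0: "\<And>t. t \<in> {a..b} \<Longrightarrow> 0 \<le> m t"
    and le: "\<And>x. x \<in> {a..b} \<Longrightarrow> m x \<le> integral {x..b} (\<lambda>t. k t * m t)"
    and x: "x \<in> {a..b}"
  shows "m x = 0"
proof -
  have "m (- (- x)) = 0"
  proof (rule gronwall_zero[where k = "\<lambda>t. k (- t)" and m = "\<lambda>t. m (- t)" and a = "- b" and b = "- a"])
    show "(\<lambda>t. k (- t)) absolutely_integrable_on {- b..- a}"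
      using k by (simp add: absolutely_integrable_reflect_real)
    show "continuous_on {- b..- a} (\<lambda>t. m (- t))"
      by (rule continuous_on_compose2[OF m]) (auto intro!: continuous_intros)
    show "m (- y) \<le> integral {- b..y} (\<lambda>t. k (- t) * m (- t))" if "y \<in> {- b..- a}" for y
      using le[of "- y"] that Henstock_Kurzweil_Integration.integral_reflect_real[of b "- y" "\<lambda>t. k t * m t"] by simp
  qed (use k0 m0 x in auto)
  then show ?thesis by simp
qed

section \<open>Existence of solutions on the half-line by a weighted fixed point\<close>

lemma continuous_on_half_line:
  fixes f :: "real \<Rightarrow> 'a::topological_space"
  assumes "\<And>b. 0 \<le> b \<Longrightarrow> continuous_on {0..b} f"
  shows "continuous_on {0..} f"
proof -
  have "continuous (at x within {0..}) f" if "0 \<le> x" for x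
  proof -
    have "continuous (at x within {0..x + 1}) f"
      using assms[of "x + 1"] that by (simp add: continuous_on_eq_continuous_within)
    moreover have "at x within {0..} = at x within {0..x + 1}"
      by (rule at_within_nhd[where S = "{..<x + 1}"]) auto
    ultimately show ?thesis by simp
  qed
  then show ?thesis by (simp add: continuous_on_eq_continuous_within)
qed

text \<open>Bounded continuous functions as a Banach space live on the whole line, so a function on
  the half-line is continued to the left by its value at 0.\<close>

lemma continuous_on_max_0:
  assumes "continuous_on {0::real..} f"
  shows "continuous_on UNIV (\<lambda>x. f (max 0 x))"
  by (rule continuous_on_compose2[OF assms]) (auto intro!: continuous_intros)

locale locally_integrable =
  fixes q :: "real \<Rightarrow> real"
  assumes q: "0 \<le> R \<Longrightarrow> q absolutely_integrable_on {0..R}"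
begin

text \<open>The summand 1 pays for f' = g and the summand with q for g' = q f, so one weight
  controls both components of the system.\<close>

definition K :: "real \<Rightarrow> real" where
  "K x = integral {0..x} (\<lambda>t. 1 + \<bar>q t\<bar>)"

lemma integrable_weight: "(\<lambda>t. 1 + \<bar>q t\<bar>) absolutely_integrable_on {a..b}" if "0 \<le> a" for a b
proof -
  have "(\<lambda>t. 1 + \<bar>q t\<bar>) absolutely_integrable_on {0..max 0 b}"
    by (intro set_integral_add set_integrable_abs q) auto
  then show ?thesis by (rule absolutely_integrable_on_subinterval) (use that in auto)
qed

lemma continuous_K: "continuous_on {0..} K"
  unfolding K_def
  by (intro continuous_on_half_line indefinite_integral_continuous_1
        set_lebesgue_integral_eq_integral(1) integrable_weight) simp

lemma integrable_q_mult: "(\<lambda>t. q t * f t) integrable_on {0..x}" if "continuous_on {0..} f" for f x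
proof -
  have "(\<lambda>t. q t * f t) absolutely_integrable_on {0..max 0 x}"
    by (intro absolutely_integrable_mult_continuous q continuous_on_subset[OF that]) auto
  then have "(\<lambda>t. q t * f t) absolutely_integrable_on {0..x}"
    by (rule absolutely_integrable_on_subinterval) auto
  then show ?thesis by (rule set_lebesgue_integral_eq_integral(1))
qed

text \<open>The contraction bound: u and v are the components of a pair after multiplication by
  e^(-4K), and both integrals together are dominated by D times the integral of (1 + |q|)
  e^(4K).\<close>

lemma weighted_estimate:
  assumes u: "continuous_on {0..} u" and v: "continuous_on {0..} v" and x: "0 \<le> x"
    and uD: "\<And>t. \<bar>u t\<bar> \<le> D" and vD: "\<And>t. \<bar>v t\<bar> \<le> D"
  shows "\<bar>integral {0..x} (\<lambda>t. v t * exp (4 * K t))\<bar> +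
         \<bar>integral {0..x} (\<lambda>t. q t * (u t * exp (4 * K t)))\<bar> \<le> D * (exp (4 * K x) / 2)"
proof -
  let ?e = "\<lambda>t. exp (4 * K t)"
  have e: "continuous_on {0..} ?e" by (intro continuous_intros continuous_K)
  have D: "0 \<le> D" using uD[of 0] by linarith
  have e_int: "?e integrable_on {0..x}"
    by (intro integrable_continuous_real continuous_on_subset[OF e]) auto
  have qe: "(\<lambda>t. \<bar>q t\<bar> * ?e t) integrable_on {0..x}"
    by (intro set_lebesgue_integral_eq_integral(1) absolutely_integrable_mult_continuous
          set_integrable_abs q x continuous_on_subset[OF e]) auto
  have "norm (integral {0..x} (\<lambda>t. v t * ?e t)) \<le> integral {0..x} (\<lambda>t. D * ?e t)"
  proof (rule integral_norm_bound_integral)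
    show "(\<lambda>t. v t * ?e t) integrable_on {0..x}"
      by (intro integrable_continuous_real continuous_intros continuous_on_subset[OF e]
            continuous_on_subset[OF v]) auto
  qed (auto intro!: integrable_on_mult_right e_int mult_right_mono vD simp: abs_mult)
  moreover have "norm (integral {0..x} (\<lambda>t. q t * (u t * ?e t))) \<le> integral {0..x} (\<lambda>t. D * (\<bar>q t\<bar> * ?e t))"
  proof (rule integral_norm_bound_integral)
    show "(\<lambda>t. q t * (u t * ?e t)) integrable_on {0..x}"
      by (intro integrable_q_mult continuous_intros u e)
    show "norm (q t * (u t * ?e t)) \<le> D * (\<bar>q t\<bar> * ?e t)" for t
      using mult_right_mono[OF uD[of t], of "\<bar>q t\<bar> * ?e t"] by (simp add: abs_mult algebra_simps)
  qed (intro integrable_on_mult_right qe)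
  ultimately have "\<bar>integral {0..x} (\<lambda>t. v t * ?e t)\<bar> + \<bar>integral {0..x} (\<lambda>t. q t * (u t * ?e t))\<bar>
      \<le> D * (integral {0..x} ?e + integral {0..x} (\<lambda>t. \<bar>q t\<bar> * ?e t))"
    by (simp add: distrib_left)
  also have "integral {0..x} ?e + integral {0..x} (\<lambda>t. \<bar>q t\<bar> * ?e t)
      = integral {0..x} (\<lambda>t. (1 + \<bar>q t\<bar>) * ?e t)"
    by (simp add: integral_add[OF e_int qe, symmetric] distrib_right)
  also have "\<dots> \<le> exp (4 * K x) / 2"
    unfolding K_def
  proof (rule integral_exp_primitive_le)
    show "(\<lambda>t. 1 + \<bar>q t\<bar>) integrable_on {0..x}"
      by (intro set_lebesgue_integral_eq_integral(1) integrable_weight) simp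
    show "(\<lambda>t. (1 + \<bar>q t\<bar>) * exp (4 * integral {0..t} (\<lambda>t. 1 + \<bar>q t\<bar>))) integrable_on {0..x}"
      using integrable_add[OF e_int qe] by (simp add: K_def distrib_right)
  qed (use x in auto)
  finally show ?thesis using D by (simp add: mult_left_mono)
qed

text \<open>
  The integral operator is a contraction with constant \<open>1/2\<close> for the supremum norm with
  weight \<open>e\<^sup>-\<^sup>4\<^sup>K\<close> on the whole half-line, so a single fixed point is a global solution.
\<close>

lemma integral_equation_solvable:
  obtains f g where "continuous_on {0..} f" "continuous_on {0..} g"
    "\<And>x. 0 \<le> x \<Longrightarrow> f x = \<alpha> + integral {0..x} g"
    "\<And>x. 0 \<le> x \<Longrightarrow> g x = \<beta> + integral {0..x} (\<lambda>t. q t * f t)"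
proof -
  let ?e = "\<lambda>t. exp (4 * K t)"
  have e: "continuous_on {0..} ?e" by (intro continuous_intros continuous_K)
  define I1 where "I1 v x = integral {0..x} (\<lambda>t. v t * ?e t)" for v :: "real \<Rightarrow> real" and x
  define I2 where "I2 u x = integral {0..x} (\<lambda>t. q t * (u t * ?e t))" for u :: "real \<Rightarrow> real" and x
  \<comment> \<open>The integral operator in the rescaled unknown w = e^(-4K) (f, g); at the end the
    rescaling is undone by multiplying with e^(4K).\<close>
  define G where "G w x = (exp (- (4 * K x)) * (\<alpha> + I1 (\<lambda>t. snd (w t)) x),
      exp (- (4 * K x)) * (\<beta> + I2 (\<lambda>t. fst (w t)) x))" for w :: "real \<Rightarrow> real \<times> real" and x
  define T where "T w x = G w (max 0 x)" for w :: "real \<Rightarrow> real \<times> real" and x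
  have K0: "0 \<le> K x" for x unfolding K_def
    by (intro integral_nonneg set_lebesgue_integral_eq_integral(1) integrable_weight) auto
  have uv: "continuous_on {0..} (\<lambda>t. fst (w t))" "continuous_on {0..} (\<lambda>t. snd (w t))"
    for w :: "real \<Rightarrow>\<^sub>C (real \<times> real)"
    by (intro continuous_intros continuous_on_apply_bcontfun)+
  have I1_int: "(\<lambda>t. v t * ?e t) integrable_on {0..x}" if "continuous_on {0..} v" for v x
    by (intro integrable_continuous_real continuous_intros continuous_on_subset[OF e]
          continuous_on_subset[OF that]) auto
  have I2_int: "(\<lambda>t. q t * (u t * ?e t)) integrable_on {0..x}" if "continuous_on {0..} u" for u x
    by (intro integrable_q_mult continuous_intros that e)
  have est: "\<bar>I1 v x\<bar> + \<bar>I2 u x\<bar> \<le> D * (?e x / 2)"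
    if "continuous_on {0..} u" "continuous_on {0..} v" "0 \<le> x" "\<And>t. \<bar>u t\<bar> \<le> D" "\<And>t. \<bar>v t\<bar> \<le> D" for u v x D
    unfolding I1_def I2_def by (rule weighted_estimate) (use that in auto)
  have norm_le: "norm (exp (- (4 * K x)) * a, exp (- (4 * K x)) * b) \<le> exp (- (4 * K x)) * (\<bar>a\<bar> + \<bar>b\<bar>)" for a b x
    using norm_Pair_le[of "exp (- (4 * K x)) * a" "exp (- (4 * K x)) * b"]
    by (simp add: abs_mult distrib_left)
  have T_in: "T w \<in> bcontfun" for w :: "real \<Rightarrow>\<^sub>C (real \<times> real)"
  proof (rule bcontfun_normI)
    have "continuous_on {0..} (G w)"
      unfolding G_def I1_def I2_def
      by (intro continuous_intros continuous_K)
         (intro continuous_on_half_line indefinite_integral_continuous_1 I1_int I2_int uv)+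
    then show "continuous_on UNIV (T w)"
      unfolding T_def by (rule continuous_on_max_0)
    fix x :: real
    define y where "y = max 0 x"
    let ?a = "I1 (\<lambda>t. snd (w t)) y" and ?b = "I2 (\<lambda>t. fst (w t)) y"
    have bd: "\<bar>fst (w t)\<bar> \<le> norm w" "\<bar>snd (w t)\<bar> \<le> norm w" for t
      using norm_bounded[of w t] norm_fst_le[of "fst (w t)" "snd (w t)"] norm_snd_le[of "snd (w t)" "fst (w t)"]
      by auto
    have "norm (T w x) \<le> exp (- (4 * K y)) * (\<bar>\<alpha> + ?a\<bar> + \<bar>\<beta> + ?b\<bar>)"
      unfolding T_def y_def[symmetric] G_def by (rule norm_le)
    also have "\<dots> \<le> exp (- (4 * K y)) * (\<bar>\<alpha>\<bar> + \<bar>\<beta>\<bar> + norm w * (?e y / 2))"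
    proof (rule mult_left_mono)
      have "\<bar>?a\<bar> + \<bar>?b\<bar> \<le> norm w * (?e y / 2)"
        by (rule est[OF uv(1) uv(2) _ bd]) (simp add: y_def)
      then show "\<bar>\<alpha> + ?a\<bar> + \<bar>\<beta> + ?b\<bar> \<le> \<bar>\<alpha>\<bar> + \<bar>\<beta>\<bar> + norm w * (?e y / 2)"
        by linarith
    qed simp
    also have "\<dots> = exp (- (4 * K y)) * (\<bar>\<alpha>\<bar> + \<bar>\<beta>\<bar>) + norm w / 2"
      by (simp add: distrib_left exp_minus)
    also have "\<dots> \<le> 1 * (\<bar>\<alpha>\<bar> + \<bar>\<beta>\<bar>) + norm w / 2"
      using K0[of y] by (intro add_right_mono mult_right_mono) auto
    finally show "norm (T w x) \<le> \<bar>\<alpha>\<bar> + \<bar>\<beta>\<bar> + norm w / 2" by simp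
  qed
  define B where "B w = Bcontfun (T (apply_bcontfun w))" for w
  have B: "apply_bcontfun (B w) = T w" for w
    unfolding B_def by (rule Bcontfun_inverse[OF T_in])
  have "dist (B w) (B z) \<le> 1/2 * dist w z" for w z
  proof (rule dist_bound)
    fix x :: real
    define y where "y = max 0 x"
    have y: "0 \<le> y" by (simp add: y_def)
    have bd: "\<bar>fst (w t) - fst (z t)\<bar> \<le> dist w z" "\<bar>snd (w t) - snd (z t)\<bar> \<le> dist w z" for t
      using dist_bounded[of w t z] dist_fst_le[of "w t" "z t"] dist_snd_le[of "w t" "z t"]
      by (auto simp: dist_real_def)
    have I1_diff: "I1 (\<lambda>t. snd (w t)) y - I1 (\<lambda>t. snd (z t)) y = I1 (\<lambda>t. snd (w t) - snd (z t)) y"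
      unfolding I1_def integral_diff[OF I1_int[OF uv(2)] I1_int[OF uv(2)], symmetric]
      by (simp add: left_diff_distrib)
    have I2_diff: "I2 (\<lambda>t. fst (w t)) y - I2 (\<lambda>t. fst (z t)) y = I2 (\<lambda>t. fst (w t) - fst (z t)) y"
      unfolding I2_def integral_diff[OF I2_int[OF uv(1)] I2_int[OF uv(1)], symmetric]
      by (simp add: left_diff_distrib right_diff_distrib)
    have "dist (B w x) (B z x) = norm (T w x - T z x)" by (simp add: B dist_norm)
    also have "T w x - T z x = (exp (- (4 * K y)) * I1 (\<lambda>t. snd (w t) - snd (z t)) y,
        exp (- (4 * K y)) * I2 (\<lambda>t. fst (w t) - fst (z t)) y)"
      unfolding T_def y_def[symmetric] G_def I1_diff[symmetric] I2_diff[symmetric]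
      by (simp add: algebra_simps)
    also have "norm \<dots> \<le> exp (- (4 * K y)) *
        (\<bar>I1 (\<lambda>t. snd (w t) - snd (z t)) y\<bar> + \<bar>I2 (\<lambda>t. fst (w t) - fst (z t)) y\<bar>)"
      by (rule norm_le)
    also have "\<dots> \<le> exp (- (4 * K y)) * (dist w z * (?e y / 2))"
      by (intro mult_left_mono est y bd continuous_intros uv) auto
    also have "\<dots> = 1/2 * dist w z" by (simp add: exp_minus)
    finally show "dist (B w x) (B z x) \<le> 1/2 * dist w z" .
  qed
  then obtain w where "B w = w"
    using banach_fix_type[of "1/2" B] by auto
  then have wT: "apply_bcontfun w = T w"
    using B[of w] by simp
  have w: "w x = G w x" if "0 \<le> x" for x
    using fun_cong[OF wT, of x] unfolding T_def max_absorb2[OF that] .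
  show ?thesis
  proof
    show "continuous_on {0..} (\<lambda>t. fst (w t) * ?e t)" "continuous_on {0..} (\<lambda>t. snd (w t) * ?e t)"
      by (intro continuous_intros uv e)+
    fix x :: real assume x: "0 \<le> x"
    show "fst (w x) * ?e x = \<alpha> + integral {0..x} (\<lambda>t. snd (w t) * ?e t)"
      using arg_cong[OF w[OF x], of fst] by (simp add: G_def I1_def exp_minus field_simps)
    show "snd (w x) * ?e x = \<beta> + integral {0..x} (\<lambda>t. q t * (fst (w t) * ?e t))"
      using arg_cong[OF w[OF x], of snd] by (simp add: G_def I2_def exp_minus field_simps)
  qed
qed

end

text \<open>The first-order system in increments over all subintervals. This form treats both
  endpoints alike, so uniqueness can start at either, and it is stable under restriction and linear
  combination although g is differentiable only almost everywhere.\<close>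

definition integral_solution where
  "integral_solution q a b f g \<longleftrightarrow> continuous_on {a..b} f \<and> continuous_on {a..b} g \<and>
     (\<forall>x y. a \<le> x \<and> x \<le> y \<and> y \<le> b \<longrightarrow> (g has_integral f y - f x) {x..y} \<and>
        ((\<lambda>t. q t * f t) has_integral g y - g x) {x..y})"
  for q f g :: "real \<Rightarrow> real"

lemma integral_solution_combine:
  assumes "integral_solution q a b f g" "integral_solution q a b f' g'"
  shows "integral_solution q a b (\<lambda>x. c * f x + d * f' x) (\<lambda>x. c * g x + d * g' x)"
  unfolding integral_solution_def
proof (intro conjI allI impI)
  fix x y assume xy: "a \<le> x \<and> x \<le> y \<and> y \<le> b"
  have "((\<lambda>t. c * g t + d * g' t) has_integral c * (f y - f x) + d * (f' y - f' x)) {x..y}"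
    using assms xy unfolding integral_solution_def by (intro has_integral_add has_integral_mult_right) auto
  then show "((\<lambda>t. c * g t + d * g' t) has_integral c * f y + d * f' y - (c * f x + d * f' x)) {x..y}"
    by (simp add: algebra_simps)
  have "((\<lambda>t. c * (q t * f t) + d * (q t * f' t)) has_integral c * (g y - g x) + d * (g' y - g' x)) {x..y}"
    using assms xy unfolding integral_solution_def by (intro has_integral_add has_integral_mult_right) auto
  then show "((\<lambda>t. q t * (c * f t + d * f' t)) has_integral c * g y + d * g' y - (c * g x + d * g' x)) {x..y}"
    by (simp add: algebra_simps)
qed (use assms in \<open>auto simp: integral_solution_def intro!: continuous_intros\<close>)

lemma integral_solution_cong:
  assumes "integral_solution q a b f g" "\<And>t. t \<in> {a..b} \<Longrightarrow> q t = q' t"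
  shows "integral_solution q' a b f g"
  unfolding integral_solution_def
proof (intro conjI allI impI)
  fix x y assume xy: "a \<le> x \<and> x \<le> y \<and> y \<le> b"
  then have "((\<lambda>t. q t * f t) has_integral g y - g x) {x..y}"
    using assms(1) by (simp add: integral_solution_def)
  then show "((\<lambda>t. q' t * f t) has_integral g y - g x) {x..y}"
    by (rule has_integral_eq[rotated]) (use assms(2) xy in auto)
qed (use assms(1) in \<open>auto simp: integral_solution_def\<close>)

lemma integral_solution_increment:
  assumes q: "q absolutely_integrable_on {a..b}" and sol: "integral_solution q a b f g"
    and xy: "a \<le> x" "x \<le> y" "y \<le> b"
  shows "\<bar>f y - f x\<bar> + \<bar>g y - g x\<bar> \<le> integral {x..y} (\<lambda>t. (1 + \<bar>q t\<bar>) * (\<bar>f t\<bar> + \<bar>g t\<bar>))"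
proof -
  have cont: "continuous_on {x..y} f" "continuous_on {x..y} g"
    using sol xy by (auto simp: integral_solution_def intro: continuous_on_subset)
  have q': "q absolutely_integrable_on {x..y}"
    using q by (rule absolutely_integrable_on_subinterval) (use xy in auto)
  have g: "(g has_integral f y - f x) {x..y}" and qf: "((\<lambda>t. q t * f t) has_integral g y - g x) {x..y}"
    using sol xy by (auto simp: integral_solution_def)
  have gi: "(\<lambda>t. \<bar>g t\<bar>) integrable_on {x..y}"
    by (intro integrable_continuous_real continuous_intros cont)
  have qi: "(\<lambda>t. \<bar>q t\<bar> * \<bar>f t\<bar>) integrable_on {x..y}"
    by (intro set_lebesgue_integral_eq_integral(1) absolutely_integrable_mult_continuous
          set_integrable_abs q' continuous_intros cont)
  have "norm (integral {x..y} g) \<le> integral {x..y} (\<lambda>t. \<bar>g t\<bar>)"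
    by (rule integral_norm_bound_integral) (use g gi in \<open>auto simp: has_integral_integrable\<close>)
  moreover have "norm (integral {x..y} (\<lambda>t. q t * f t)) \<le> integral {x..y} (\<lambda>t. \<bar>q t\<bar> * \<bar>f t\<bar>)"
    by (rule integral_norm_bound_integral) (use qf qi in \<open>auto simp: has_integral_integrable abs_mult\<close>)
  moreover have "integral {x..y} (\<lambda>t. \<bar>g t\<bar>) + integral {x..y} (\<lambda>t. \<bar>q t\<bar> * \<bar>f t\<bar>)
      \<le> integral {x..y} (\<lambda>t. (1 + \<bar>q t\<bar>) * (\<bar>f t\<bar> + \<bar>g t\<bar>))"
    unfolding integral_add[OF gi qi, symmetric]
  proof (rule integral_le[OF integrable_add[OF gi qi]])
    show "(\<lambda>t. (1 + \<bar>q t\<bar>) * (\<bar>f t\<bar> + \<bar>g t\<bar>)) integrable_on {x..y}"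
      by (intro set_lebesgue_integral_eq_integral(1) absolutely_integrable_mult_continuous
            set_integral_add set_integrable_abs q' continuous_intros cont) auto
  qed (auto simp: algebra_simps)
  ultimately show ?thesis
    using g qf by (simp add: integral_unique)
qed

text \<open>By \<open>integral_solution_increment\<close>, |f| + |g| satisfies the Gronwall
  inequality with weight 1 + |q|, run away from c. The left end is used to compare tails, the right
  end to keep independence of solutions.\<close>

lemma integral_solution_zero:
  assumes q: "q absolutely_integrable_on {a..b}" and sol: "integral_solution q a b f g"
    and c: "c = a \<or> c = b" and c0: "f c = 0" "g c = 0" and x: "x \<in> {a..b}"
  shows "f x = 0" "g x = 0"
proof -
  let ?k = "\<lambda>t. 1 + \<bar>q t\<bar>" and ?m = "\<lambda>t. \<bar>f t\<bar> + \<bar>g t\<bar>"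
  have k: "?k absolutely_integrable_on {a..b}"
    by (intro set_integral_add set_integrable_abs q) auto
  have m: "continuous_on {a..b} ?m"
    using sol by (auto simp: integral_solution_def intro!: continuous_intros)
  have "?m x = 0"
    using c
  proof
    assume "c = a"
    show ?thesis
      by (rule gronwall_zero[OF k _ m _ _ x])
         (use integral_solution_increment[OF q sol, of a] c0 \<open>c = a\<close> in auto)
  next
    assume "c = b"
    show ?thesis
      by (rule gronwall_zero_backward[OF k _ m _ _ x])
         (use integral_solution_increment[OF q sol, of _ b] c0 \<open>c = b\<close> in auto)
  qed
  then show "f x = 0" "g x = 0" by auto
qed

section \<open>The continuum case\<close>

lemma cont_solution_integral_solution:
  assumes sol: "cont_solution V E f g" and a: "0 \<le> a"
  shows "integral_solution (\<lambda>t. V t - E) a b f g"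
  unfolding integral_solution_def
proof (intro conjI allI impI)
  have deriv: "(f has_real_derivative g x) (at x within {0..})" if "0 \<le> x" for x
    using sol that by (simp add: cont_solution_def)
  have hi: "((\<lambda>t. (V t - E) * f t) has_integral g x - g 0) {0..x}" if "0 \<le> x" for x
    using sol that by (simp add: cont_solution_def)
  show "continuous_on {a..b} f"
    using deriv a by (intro DERIV_continuous_on[where D = g]) (auto intro!: DERIV_subset[OF deriv])
  have "continuous_on {0..b} (\<lambda>x. g 0 + integral {0..x} (\<lambda>t. (V t - E) * f t))"
  proof (cases "0 \<le> b")
    case True
    then show ?thesis
      by (intro continuous_intros indefinite_integral_continuous_1 has_integral_integrable[OF hi])
  qed simp
  moreover have "g 0 + integral {0..x} (\<lambda>t. (V t - E) * f t) = g x" if "x \<in> {0..b}" for x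
    using integral_unique[OF hi[of x]] that by simp
  ultimately have "continuous_on {0..b} g" by (simp cong: continuous_on_cong_simp)
  then show "continuous_on {a..b} g" by (rule continuous_on_subset) (use a in auto)
  fix x y assume xy: "a \<le> x \<and> x \<le> y \<and> y \<le> b"
  show "(g has_integral f y - f x) {x..y}"
    by (rule fundamental_theorem_of_calculus)
       (use xy a in \<open>auto simp flip: has_real_derivative_iff_has_vector_derivative
          intro!: DERIV_subset[OF deriv]\<close>)
  have int: "(\<lambda>t. (V t - E) * f t) integrable_on {0..y}"
    by (rule has_integral_integrable[OF hi]) (use xy a in auto)
  have "integral {0..x} (\<lambda>t. (V t - E) * f t) + integral {x..y} (\<lambda>t. (V t - E) * f t)
      = integral {0..y} (\<lambda>t. (V t - E) * f t)"
    by (rule Henstock_Kurzweil_Integration.integral_combine[OF _ _ int]) (use xy a in auto)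
  then have "integral {x..y} (\<lambda>t. (V t - E) * f t) = g y - g x"
    using integral_unique[OF hi[of x]] integral_unique[OF hi[of y]] xy a by simp
  moreover have "(\<lambda>t. (V t - E) * f t) integrable_on {x..y}"
    by (rule integrable_on_subinterval[OF int]) (use xy a in auto)
  ultimately show "((\<lambda>t. (V t - E) * f t) has_integral g y - g x) {x..y}"
    using integrable_integral by fastforce
qed

lemma cont_potential_minus_energy:
  assumes "cont_potential V" "0 \<le> a"
  shows "(\<lambda>t. V t - E) absolutely_integrable_on {a..b}"
proof -
  have "(\<lambda>t. V t - E) absolutely_integrable_on {0..max 0 b}"
    using assms(1) by (intro set_integral_diff) (auto simp: cont_potential_def)
  then show ?thesis by (rule absolutely_integrable_on_subinterval) (use assms(2) in auto)
qed

lemma cont_solution_exists: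
  assumes "cont_potential V"
  shows "\<exists>f g. cont_solution V E f g \<and> f 0 = \<alpha> \<and> g 0 = \<beta>"
proof -
  interpret locally_integrable "\<lambda>t. V t - E"
    by standard (use cont_potential_minus_energy[OF assms] in simp)
  obtain f g where f: "continuous_on {0..} f" and g: "continuous_on {0..} g"
    and feq: "\<And>x. 0 \<le> x \<Longrightarrow> f x = \<alpha> + integral {0..x} g"
    and geq: "\<And>x. 0 \<le> x \<Longrightarrow> g x = \<beta> + integral {0..x} (\<lambda>t. (V t - E) * f t)"
    using integral_equation_solvable by blast
  have 0: "f 0 = \<alpha>" "g 0 = \<beta>" using feq[of 0] geq[of 0] by simp_all
  have "(f has_real_derivative g x) (at x within {0..})" if x: "0 \<le> x" for x
  proof -
    have "((\<lambda>y. \<alpha> + integral {0..y} g) has_real_derivative g x) (at x within {0..x + 1})"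
      by (rule derivative_eq_intros integral_has_real_derivative refl)+
         (use x in \<open>auto intro: continuous_on_subset[OF g]\<close>)
    then have "(f has_real_derivative g x) (at x within {0..x + 1})"
      by (rule has_field_derivative_transform_within[where d = 1]) (use x feq in auto)
    moreover have "at x within {0..} = at x within {0..x + 1}"
      by (rule at_within_nhd[where S = "{..<x + 1}"]) auto
    ultimately show ?thesis by simp
  qed
  moreover have "((\<lambda>t. (V t - E) * f t) has_integral (g x - g 0)) {0..x}" if "0 \<le> x" for x
    using integrable_integral[OF integrable_q_mult[OF f, of x]] geq[OF that] 0 by simp
  ultimately show ?thesis using 0 by (auto simp: cont_solution_def)
qed

lemma cont_phi1_solution:
  assumes "cont_potential V"
  obtains g where "cont_solution V E (cont_phi1 V \<theta> E) g" "cont_phi1 V \<theta> E 0 = sin \<theta>" "g 0 = - cos \<theta>"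
proof -
  have "\<exists>g. cont_solution V E (cont_phi1 V \<theta> E) g \<and> cont_phi1 V \<theta> E 0 = sin \<theta> \<and> g 0 = - cos \<theta>"
    using someI_ex[OF cont_solution_exists[OF assms, of E "sin \<theta>" "- cos \<theta>"]]
    unfolding cont_phi1_def .
  then show ?thesis using that by blast
qed

lemma cont_solution_continuous: "cont_solution V E f g \<Longrightarrow> continuous_on {0..} f"
  unfolding cont_solution_def by (intro DERIV_continuous_on[where D = g]) auto

section \<open>Norms on [0, L] of continuous functions\<close>

lemma integrable_sq: "(\<lambda>x. \<bar>f x\<bar>\<^sup>2) integrable_on {0..L}" if "continuous_on {0..} f" for f :: "real \<Rightarrow> real"
  by (intro integrable_continuous_real continuous_intros continuous_on_subset[OF that]) auto

lemma cont_norm_nonneg: "0 \<le> cont_norm f L"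
proof -
  have "0 \<le> integral {0..L} (\<lambda>x. \<bar>f x\<bar>\<^sup>2)"
    by (cases "(\<lambda>x. \<bar>f x\<bar>\<^sup>2) integrable_on {0..L}")
       (auto intro: integral_nonneg simp: not_integrable_integral)
  then show ?thesis by (simp add: cont_norm_def)
qed

lemma cont_norm_mono:
  assumes f: "continuous_on {0..} f" and "0 \<le> L" "L \<le> M"
  shows "cont_norm f L \<le> cont_norm f M"
  unfolding cont_norm_def real_sqrt_le_iff
  by (rule integral_subset_le) (use assms integrable_sq[OF f] in auto)

lemma cont_norm_combine:
  assumes f: "continuous_on {0..} f" and g: "continuous_on {0..} g"
  shows "cont_norm (\<lambda>x. a * f x + b * g x) L \<le> \<bar>a\<bar> * cont_norm f L + \<bar>b\<bar> * cont_norm g L"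
proof -
  define A where "A = integral {0..L} (\<lambda>x. \<bar>f x\<bar>\<^sup>2)"
  define B where "B = integral {0..L} (\<lambda>x. \<bar>g x\<bar>\<^sup>2)"
  define M where "M = integral {0..L} (\<lambda>x. f x * g x)"
  have fg: "(\<lambda>x. f x * g x) integrable_on {0..L}"
    by (intro integrable_continuous_real continuous_intros continuous_on_subset[OF f]
          continuous_on_subset[OF g]) auto
  have eq: "integral {0..L} (\<lambda>x. \<bar>a * f x + b * g x\<bar>\<^sup>2) = a\<^sup>2 * A + 2 * a * b * M + b\<^sup>2 * B" for a b
  proof -
    have "integral {0..L} (\<lambda>x. \<bar>a * f x + b * g x\<bar>\<^sup>2)
        = integral {0..L} (\<lambda>x. a\<^sup>2 * \<bar>f x\<bar>\<^sup>2 + 2 * a * b * (f x * g x) + b\<^sup>2 * \<bar>g x\<bar>\<^sup>2)"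
      by (simp add: power2_eq_square algebra_simps)
    also have "\<dots> = a\<^sup>2 * A + 2 * a * b * M + b\<^sup>2 * B"
      unfolding A_def B_def M_def
      by (intro integral_unique has_integral_add has_integral_mult_right integrable_integral
            integrable_sq f g fg)
    finally show ?thesis .
  qed
  have "0 \<le> a\<^sup>2 * A + 2 * a * b * M + b\<^sup>2 * B" for a b
    unfolding eq[symmetric]
    by (intro integral_nonneg integrable_sq continuous_intros f g) auto
  from sqrt_quadratic_form_le[OF this] show ?thesis
    unfolding cont_norm_def eq A_def[symmetric] B_def[symmetric] .
qed

text \<open>The difference of the functions lives on [0, R], so its norm is constant from R on; the
  triangle inequality in both directions makes that constant the bound.\<close>

lemma cont_norm_eventually_equal:
  assumes f: "continuous_on {0..} f" and g: "continuous_on {0..} g"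
    and eq: "\<And>x. R \<le> x \<Longrightarrow> f x = g x" and R: "0 \<le> R"
  shows "\<exists>C. \<forall>\<^sub>F L in at_top. \<bar>cont_norm f L - cont_norm g L\<bar> \<le> C"
proof
  let ?h = "\<lambda>x. f x - g x"
  have h: "continuous_on {0..} ?h" by (intro continuous_intros f g)
  show "\<forall>\<^sub>F L in at_top. \<bar>cont_norm f L - cont_norm g L\<bar> \<le> cont_norm ?h R"
    using eventually_ge_at_top[of R]
  proof eventually_elim
    case (elim L)
    have "integral {0..R} (\<lambda>x. \<bar>?h x\<bar>\<^sup>2) + integral {R..L} (\<lambda>x. \<bar>?h x\<bar>\<^sup>2) = integral {0..L} (\<lambda>x. \<bar>?h x\<bar>\<^sup>2)"
      by (rule Henstock_Kurzweil_Integration.integral_combine[OF R elim integrable_sq[OF h]])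
    moreover have "integral {R..L} (\<lambda>x. \<bar>?h x\<bar>\<^sup>2) = integral {R..L} (\<lambda>x. 0)"
      by (rule integral_cong) (simp add: eq)
    ultimately have "cont_norm ?h L = cont_norm ?h R" by (simp add: cont_norm_def)
    moreover have "cont_norm f L \<le> cont_norm g L + cont_norm ?h L"
      using cont_norm_combine[OF g h, of 1 1 L] by simp
    moreover have "cont_norm g L \<le> cont_norm f L + cont_norm ?h L"
      using cont_norm_combine[OF f h, of 1 "- 1" L] by simp
    ultimately show ?case by simp
  qed
qed

text \<open>Links square integrability with the boundedness used in \<open>S_cond\<close>. From
  bounded norms, monotone convergence is applied to the truncations to [0, k].\<close>

lemma cont_L2_iff:
  assumes f: "continuous_on {0..} f"
  shows "cont_L2 f \<longleftrightarrow> (\<exists>C. \<forall>L\<ge>0. cont_norm f L \<le> C)"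
proof
  assume "cont_L2 f"
  then have int: "(\<lambda>x. \<bar>f x\<bar>\<^sup>2) integrable_on {0..}"
    unfolding cont_L2_def by (rule set_lebesgue_integral_eq_integral(1))
  have "cont_norm f L \<le> sqrt (integral {0..} (\<lambda>x. \<bar>f x\<bar>\<^sup>2))" for L
    unfolding cont_norm_def real_sqrt_le_iff
    by (rule integral_subset_le) (use int integrable_sq[OF f] in auto)
  then show "\<exists>C. \<forall>L\<ge>0. cont_norm f L \<le> C" by blast
next
  assume "\<exists>C. \<forall>L\<ge>0. cont_norm f L \<le> C"
  then obtain C where C: "\<And>L. 0 \<le> L \<Longrightarrow> cont_norm f L \<le> C" by blast
  let ?f = "\<lambda>k x. if x \<in> {0..real k} then \<bar>f x\<bar>\<^sup>2 else 0"
  have int: "?f k integrable_on {0..}" and eq: "integral {0..} (?f k) = integral {0..real k} (\<lambda>x. \<bar>f x\<bar>\<^sup>2)" for k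
    unfolding integrable_restrict_Int integral_restrict_Int
    using integrable_sq[OF f, of "real k"] by (simp_all add: Int_absorb2)
  have "(\<lambda>x. \<bar>f x\<bar>\<^sup>2) integrable_on {0..} \<and> (\<lambda>k. integral {0..} (?f k)) \<longlonglongrightarrow> integral {0..} (\<lambda>x. \<bar>f x\<bar>\<^sup>2)"
  proof (rule monotone_convergence_increasing[OF int])
    show "(\<lambda>k. ?f k x) \<longlonglongrightarrow> \<bar>f x\<bar>\<^sup>2" if "x \<in> {0..}" for x
    proof (rule tendsto_eventually)
      obtain k0 where "x \<le> real k0" using real_arch_simple by blast
      then show "\<forall>\<^sub>F k in sequentially. ?f k x = \<bar>f x\<bar>\<^sup>2"
        using that by (intro eventually_sequentiallyI[of k0]) auto
    qed
    have "\<bar>integral {0..} (?f k)\<bar> \<le> C\<^sup>2" for k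
    proof -
      have "0 \<le> integral {0..real k} (\<lambda>x. \<bar>f x\<bar>\<^sup>2)"
        by (rule integral_nonneg[OF integrable_sq[OF f]]) auto
      then show ?thesis
        using power_mono[OF C[of "real k"] cont_norm_nonneg, of 2] unfolding eq
        by (simp add: cont_norm_def)
    qed
    then show "bounded (range (\<lambda>k. integral {0..} (?f k)))" by (auto intro!: boundedI)
  qed auto
  then show "cont_L2 f" unfolding cont_L2_def
    by (intro nonnegative_absolutely_integrable_1) auto
qed

text \<open>Instead of differentiating the Wronskian, uniqueness is run backwards: a linear relation
  between the Cauchy data at R would persist down to 0.\<close>

lemma cont_wronskian_nonzero:
  assumes V: "cont_potential V" and f: "cont_solution V E f f'" and g: "cont_solution V E g g'"
    and W0: "crossp (f 0, f' 0) (g 0, g' 0) \<noteq> 0" and R: "0 \<le> R"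
  shows "crossp (f R, f' R) (g R, g' R) \<noteq> 0"
proof
  assume "crossp (f R, f' R) (g R, g' R) = 0"
  then obtain s t where st: "s \<noteq> 0 \<or> t \<noteq> 0" "s * f R + t * g R = 0" "s * f' R + t * g' R = 0"
    by (rule crossp_eq_0_dependent) auto
  note sol = integral_solution_combine[OF cont_solution_integral_solution[OF f order_refl]
      cont_solution_integral_solution[OF g order_refl], of R s t]
  have "s * f 0 + t * g 0 = 0" "s * f' 0 + t * g' 0 = 0"
    using integral_solution_zero[OF cont_potential_minus_energy[OF V] sol, of R 0] R st by auto
  \<comment> \<open>Cramer's rule: the relation at 0 annihilates the determinant times each
    coefficient.\<close>
  then have "s * crossp (f 0, f' 0) (g 0, g' 0) = 0" "t * crossp (f 0, f' 0) (g 0, g' 0) = 0"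
    unfolding crossp_def by simp_all algebra+
  then show False using W0 st(1) by auto
qed

text \<open>Beyond R the combination also solves the equation for V, and its difference from f has
  zero Cauchy data at R. With R = 0 and equal potentials this yields linearity in the initial
  data.\<close>

lemma cont_solutions_eq_from:
  assumes V: "cont_potential V" and f: "cont_solution V E f f'"
    and g: "cont_solution V0 E g g'" and h: "cont_solution V0 E h h'"
    and R: "0 \<le> R" and eq: "\<And>x. R \<le> x \<Longrightarrow> V x = V0 x"
    and init: "(f R, f' R) = a *\<^sub>R (g R, g' R) + b *\<^sub>R (h R, h' R)"
    and x: "R \<le> x"
  shows "f x = a * g x + b * h x"
proof -
  have "integral_solution (\<lambda>t. V0 t - E) R x (\<lambda>x. a * g x + b * h x) (\<lambda>x. a * g' x + b * h' x)"
    by (intro integral_solution_combine cont_solution_integral_solution[OF _ R] g h)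
  then have "integral_solution (\<lambda>t. V t - E) R x (\<lambda>x. a * g x + b * h x) (\<lambda>x. a * g' x + b * h' x)"
    by (rule integral_solution_cong) (use eq in auto)
  note sol = integral_solution_combine[OF cont_solution_integral_solution[OF f R] this, of 1 "- 1"]
  show ?thesis
    using integral_solution_zero(1)[OF cont_potential_minus_energy[OF V R] sol, of R x] init x by auto
qed

lemma cont_norms_of_solutions:
  assumes V: "cont_potential V" and V0: "cont_potential V0"
    and R: "0 \<le> R" and eq: "\<And>x. R \<le> x \<Longrightarrow> V x = V0 x"
  shows "\<exists>e1 e2. norms_of_solutions
    (\<lambda>v. cont_norm (\<lambda>x. fst v * cont_phi1 V0 (pi / 2) E x + snd v * cont_phi1 V0 0 E x)) e1 e2
    (\<lambda>t. cont_norm (cont_phi1 V t E))"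
proof -
  let ?n = "\<lambda>v. cont_norm (\<lambda>x. fst v * cont_phi1 V0 (pi / 2) E x + snd v * cont_phi1 V0 0 E x)"
  define f where "f = cont_phi1 V0 (pi / 2) E"
  define g where "g = cont_phi1 V0 0 E"
  define F where "F = cont_phi1 V (pi / 2) E"
  define G where "G = cont_phi1 V 0 E"
  obtain f' where f: "cont_solution V0 E f f'" "f 0 = 1" "f' 0 = 0"
    unfolding f_def using cont_phi1_solution[OF V0, of E "pi / 2"] by auto
  obtain g' where g: "cont_solution V0 E g g'" "g 0 = 0" "g' 0 = - 1"
    unfolding g_def using cont_phi1_solution[OF V0, of E 0] by auto
  obtain F' where F: "cont_solution V E F F'" "F 0 = 1" "F' 0 = 0"
    unfolding F_def using cont_phi1_solution[OF V, of E "pi / 2"] by auto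
  obtain G' where G: "cont_solution V E G G'" "G 0 = 0" "G' 0 = - 1"
    unfolding G_def using cont_phi1_solution[OF V, of E 0] by auto
  have fc: "continuous_on {0..} f" and gc: "continuous_on {0..} g"
    using cont_solution_continuous f(1) g(1) by blast+
  have W0: "crossp (f R, f' R) (g R, g' R) \<noteq> 0"
    by (rule cont_wronskian_nonzero[OF V0 f(1) g(1) _ R]) (simp add: f g crossp_def)
  have W: "crossp (F R, F' R) (G R, G' R) \<noteq> 0"
    by (rule cont_wronskian_nonzero[OF V F(1) G(1) _ R]) (simp add: F G crossp_def)
  \<comment> \<open>The pairs (a, b) and (c, d) form the matrix that matches Cauchy data of the two
    equations at R; they become \<open>e1\<close> and \<open>e2\<close>.\<close>
  obtain a b where ab: "(F R, F' R) = a *\<^sub>R (f R, f' R) + b *\<^sub>R (g R, g' R)"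
    using crossp_decompose[OF W0] by blast
  obtain c d where cd: "(G R, G' R) = c *\<^sub>R (f R, f' R) + d *\<^sub>R (g R, g' R)"
    using crossp_decompose[OF W0] by blast
  have Ftail: "F x = a * f x + b * g x" and Gtail: "G x = c * f x + d * g x" if "R \<le> x" for x
    using cont_solutions_eq_from[OF V F(1) f(1) g(1) R eq ab that]
      cont_solutions_eq_from[OF V G(1) f(1) g(1) R eq cd that] by auto
  have lin: "cont_phi1 V t E x = sin t * F x + cos t * G x" if "0 \<le> x" for t x
  proof -
    obtain h where "cont_solution V E (cont_phi1 V t E) h" "cont_phi1 V t E 0 = sin t" "h 0 = - cos t"
      using cont_phi1_solution[OF V] by blast
    then show ?thesis
      using cont_solutions_eq_from[OF V _ F(1) G(1) order_refl refl _ that, of _ h "sin t" "cos t"] F G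
      by auto
  qed
  have cont: "continuous_on {0..} (cont_phi1 V t E)" for t
    using cont_phi1_solution[OF V] cont_solution_continuous by metis
  have "norms_of_solutions ?n (a, b) (c, d) (\<lambda>t. cont_norm (cont_phi1 V t E))"
    unfolding f_def[symmetric] g_def[symmetric]
  proof
    fix L :: real and v w :: "real \<times> real" and r s :: real
    show "0 \<le> cont_norm (\<lambda>x. fst v * f x + snd v * g x) L" by (rule cont_norm_nonneg)
    show "cont_norm (\<lambda>x. fst (r *\<^sub>R v + s *\<^sub>R w) * f x + snd (r *\<^sub>R v + s *\<^sub>R w) * g x) L
        \<le> \<bar>r\<bar> * cont_norm (\<lambda>x. fst v * f x + snd v * g x) L + \<bar>s\<bar> * cont_norm (\<lambda>x. fst w * f x + snd w * g x) L"
      using cont_norm_combine[of "\<lambda>x. fst v * f x + snd v * g x" "\<lambda>x. fst w * f x + snd w * g x" r s L]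
      by (simp add: algebra_simps continuous_intros fc gc)
  next
    \<comment> \<open>Multiplicativity of the determinant turns the two nonzero Wronskians into
      independence of \<open>e1\<close> and \<open>e2\<close>.\<close>
    have "crossp (F R, F' R) (G R, G' R) = crossp (a, b) (c, d) * crossp (f R, f' R) (g R, g' R)"
      using ab cd by (simp add: crossp_def algebra_simps)
    then show "crossp (a, b) (c, d) \<noteq> 0" using W by auto
  next
    fix t
    show "\<exists>C. \<forall>\<^sub>F L in at_top. \<bar>cont_norm (cont_phi1 V t E) L -
        cont_norm (\<lambda>x. fst (sin t *\<^sub>R (a, b) + cos t *\<^sub>R (c, d)) * f x +
          snd (sin t *\<^sub>R (a, b) + cos t *\<^sub>R (c, d)) * g x) L\<bar> \<le> C"
      by (rule cont_norm_eventually_equal[OF cont _ _ R])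
         (use R in \<open>auto simp: lin Ftail Gtail algebra_simps intro!: continuous_intros fc gc\<close>)
  next
    fix t L :: real
    show "0 \<le> cont_norm (cont_phi1 V t E) L" by (rule cont_norm_nonneg)
  next
    fix t L M :: real
    assume "0 \<le> L" "L \<le> M"
    then show "cont_norm (cont_phi1 V t E) L \<le> cont_norm (cont_phi1 V t E) M"
      by (rule cont_norm_mono[OF cont])
  next
    fix t
    let ?u = "cont_phi1 V t E"
    obtain h where h: "cont_solution V E ?u h" "?u 0 = sin t" "h 0 = - cos t"
      using cont_phi1_solution[OF V] by blast
    \<comment> \<open>A solution vanishing on [0, 1] would have value 0 and one-sided derivative 0
      at 0, against sin^2 + cos^2 = 1.\<close>
    have "cont_norm ?u 1 \<noteq> 0"
    proof
      assume "cont_norm ?u 1 = 0"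
      then have "integral {0..1} (\<lambda>x. \<bar>?u x\<bar>\<^sup>2) = 0" by (simp add: cont_norm_def)
      moreover have "continuous_on {0..1} (\<lambda>x. \<bar>?u x\<bar>\<^sup>2)"
        by (intro continuous_intros continuous_on_subset[OF cont]) auto
      ultimately have zero: "?u x = 0" if "x \<in> {0..1}" for x
        using integral_eq_0_iff[of 0 1 "\<lambda>x. \<bar>?u x\<bar>\<^sup>2"] that by simp
      have "(?u has_vector_derivative h 0) (at 0 within {0..1})"
        using h(1) by (auto simp: cont_solution_def has_real_derivative_iff_has_vector_derivative
            intro: has_vector_derivative_within_subset)
      moreover have "(?u has_vector_derivative 0) (at 0 within {0..1})"
        by (rule has_vector_derivative_transform[OF _ _ has_vector_derivative_const]) (use zero in auto)
      ultimately have "h 0 = 0"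
        using vector_derivative_unique_within_closed_interval[of 0 1 0 ?u "h 0" 0] by simp
      then show False using zero[of 0] h(2,3) sin_cos_squared_add[of t] by simp
    qed
    then show "\<exists>L\<ge>0. 0 < cont_norm ?u L"
      using cont_norm_nonneg[of ?u 1] by (intro exI[of _ 1]) auto
  qed
  then show ?thesis unfolding f_def g_def by blast
qed

lemma cont_S_beta_transfer:
  assumes V: "cont_potential V" and V0: "cont_potential V0"
    and R: "0 \<le> R" and eq: "\<And>x. R \<le> x \<Longrightarrow> V x = V0 x"
  shows "E \<in> cont_S V \<longleftrightarrow> E \<in> cont_S V0"
    and "E \<in> cont_S V0 \<Longrightarrow> cont_beta E V = cont_beta E V0"
proof -
  let ?n = "\<lambda>v. cont_norm (\<lambda>x. fst v * cont_phi1 V0 (pi / 2) E x + snd v * cont_phi1 V0 0 E x)"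
  obtain e1 e2 where e: "norms_of_solutions ?n e1 e2 (\<lambda>t. cont_norm (cont_phi1 V t E))"
    using cont_norms_of_solutions[OF V V0 R eq] by blast
  \<comment> \<open>V0 is compared with itself, which places its norms over the same seminorm family
    as those of V.\<close>
  obtain d1 d2 where d: "norms_of_solutions ?n d1 d2 (\<lambda>t. cont_norm (cont_phi1 V0 t E))"
    using cont_norms_of_solutions[OF V0 V0 R] by blast
  have cont: "continuous_on {0..} (cont_phi1 U t E)" if "cont_potential U" for U t
    using cont_phi1_solution[OF that] cont_solution_continuous by metis
  have S: "E \<in> cont_S U \<longleftrightarrow> norms_of_solutions.S_cond (\<lambda>t. cont_norm (cont_phi1 U t E))"
    and beta: "cont_beta E U = norms_of_solutions.beta (\<lambda>t. cont_norm (cont_phi1 U t E))"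
    if U: "cont_potential U" and n: "norms_of_solutions ?n c1 c2 (\<lambda>t. cont_norm (cont_phi1 U t E))" for U c1 c2
  proof -
    interpret norms_of_solutions ?n c1 c2 "\<lambda>t. cont_norm (cont_phi1 U t E)" by (fact n)
    have th: "cont_theta U E = theta"
      by (simp add: theta_def cont_theta_def cont_subordinate_def cont_phi2_def)
    show "E \<in> cont_S U \<longleftrightarrow> S_cond"
      by (simp add: cont_S_def S_cond_def th cont_subordinate_def cont_phi2_def cont_L2_iff[OF cont[OF U]])
    show "cont_beta E U = beta"
      by (simp add: cont_beta_def beta_def th cont_phi2_def)
  qed
  show "E \<in> cont_S V \<longleftrightarrow> E \<in> cont_S V0"
    unfolding S[OF V e] S[OF V0 d] by (rule S_beta_transfer(1)[OF e d])
  show "cont_beta E V = cont_beta E V0" if "E \<in> cont_S V0"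
    using S_beta_transfer(2)[OF e d] that unfolding S[OF V0 d] beta[OF V e] beta[OF V0 d] .
qed

lemma cont_compact_support_bound:
  assumes "cont_compact_support W"
  obtains R where "0 \<le> R" "\<And>x. R \<le> x \<Longrightarrow> W x = 0"
proof -
  have "bounded {x. 0 \<le> x \<and> W x \<noteq> 0}"
    using assms unfolding cont_compact_support_def
    by (meson bounded_subset closure_subset compact_imp_bounded)
  then obtain b where b: "\<And>x. 0 \<le> x \<Longrightarrow> W x \<noteq> 0 \<Longrightarrow> \<bar>x\<bar> \<le> b"
    by (auto simp: bounded_iff)
  have "W x = 0" if "\<bar>b\<bar> + 1 \<le> x" for x
  proof -
    have "0 \<le> x" "\<not> \<bar>x\<bar> \<le> b" using that by auto
    then show ?thesis using b by blast
  qed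
  then show ?thesis by (intro that[of "\<bar>b\<bar> + 1"]) auto
qed

lemma cont_compact_perturbation:
  assumes V0: "cont_potential V0" and W: "cont_potential W" "cont_compact_support W"
    and V: "\<And>x. 0 \<le> x \<Longrightarrow> V x = V0 x + W x"
  shows "cont_S V = cont_S V0" and "E \<in> cont_S V0 \<Longrightarrow> cont_beta E V = cont_beta E V0"
proof -
  have Vp: "cont_potential V"
    unfolding cont_potential_def
  proof (intro allI impI)
    fix R :: real assume "0 \<le> R"
    then have "(\<lambda>x. V0 x + W x) absolutely_integrable_on {0..R}"
      using V0 W(1) by (intro set_integral_add) (auto simp: cont_potential_def)
    then show "V absolutely_integrable_on {0..R}"
      by (rule absolutely_integrable_spike[where S = "{}"]) (use V in auto)
  qed
  obtain R where R: "0 \<le> R" "\<And>x. R \<le> x \<Longrightarrow> W x = 0"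
    using cont_compact_support_bound[OF W(2)] by blast
  have eq: "V x = V0 x" if "R \<le> x" for x using V[of x] R that by auto
  show "cont_S V = cont_S V0" using cont_S_beta_transfer(1)[OF Vp V0 R(1) eq] by blast
  show "E \<in> cont_S V0 \<Longrightarrow> cont_beta E V = cont_beta E V0"
    by (rule cont_S_beta_transfer(2)[OF Vp V0 R(1) eq])
qed

section \<open>The discrete case\<close>

lemma disc_solution_step:
  assumes "disc_solution V E f"
  shows "f (Suc (Suc n)) = (E - V (Suc n)) * f (Suc n) - f n"
proof -
  have "f (Suc n + 1) + f (Suc n - 1) + V (Suc n) * f (Suc n) = E * f (Suc n)"
    using assms unfolding disc_solution_def by (metis le_add1 plus_1_eq_Suc)
  then show ?thesis by (simp add: algebra_simps)
qed

lemma disc_solution_exists: "\<exists>f. disc_solution V E f \<and> f 0 = \<alpha> \<and> f 1 = \<beta>"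
proof -
  define r where "r = rec_nat (\<alpha>, \<beta>) (\<lambda>n (x, y). (y, (E - V (Suc n)) * y - x))"
  have r0: "r 0 = (\<alpha>, \<beta>)" and rS: "r (Suc n) = (snd (r n), (E - V (Suc n)) * snd (r n) - fst (r n))" for n
    by (simp_all add: r_def case_prod_beta)
  have "disc_solution V E (\<lambda>n. fst (r n))"
    unfolding disc_solution_def
  proof (intro allI impI)
    fix n :: nat assume "1 \<le> n"
    then obtain m where "n = Suc m" by (cases n) auto
    then show "fst (r (n + 1)) + fst (r (n - 1)) + V n * fst (r n) = E * fst (r n)"
      by (simp add: rS algebra_simps)
  qed
  then show ?thesis by (intro exI[of _ "\<lambda>n. fst (r n)"]) (simp add: r0 rS)
qed

text \<open>The data sit at R and R + 1, and the first value computed from them, at R + 2, uses the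
  potential at R + 1. Hence agreement is required strictly beyond R, and R = 0 covers the whole
  half-line.\<close>

lemma disc_solutions_eq_from:
  assumes f: "disc_solution V E f" and g: "disc_solution V0 E g" and h: "disc_solution V0 E h"
    and eq: "\<And>n. R < n \<Longrightarrow> V n = V0 n"
    and init: "(f R, f (Suc R)) = a *\<^sub>R (g R, g (Suc R)) + b *\<^sub>R (h R, h (Suc R))"
    and n: "R \<le> n"
  shows "f n = a * g n + b * h n"
proof -
  have "f n = a * g n + b * h n \<and> f (Suc n) = a * g (Suc n) + b * h (Suc n)"
    using n
  proof (induction n rule: dec_induct)
    case base
    then show ?case using init by simp
  next
    case (step n)
    then show ?case
      using eq[of "Suc n"]
      by (simp add: disc_solution_step[OF f] disc_solution_step[OF g] disc_solution_step[OF h] algebra_simps)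
  qed
  then show ?thesis ..
qed

lemma disc_phi1_solution:
  shows "disc_solution V E (disc_phi1 V \<theta> E)" "disc_phi1 V \<theta> E 0 = sin \<theta>" "disc_phi1 V \<theta> E 1 = - cos \<theta>"
proof -
  have "\<exists>!f. disc_solution V E f \<and> f 0 = sin \<theta> \<and> f 1 = - cos \<theta>"
  proof (rule ex_ex1I[OF disc_solution_exists])
    fix f g assume "disc_solution V E f \<and> f 0 = sin \<theta> \<and> f 1 = - cos \<theta>"
      and "disc_solution V E g \<and> g 0 = sin \<theta> \<and> g 1 = - cos \<theta>"
    then show "f = g"
      using disc_solutions_eq_from[of V E f V g g 0 1 0] by (intro ext) auto
  qed
  from theI'[OF this]
  show "disc_solution V E (disc_phi1 V \<theta> E)" "disc_phi1 V \<theta> E 0 = sin \<theta>" "disc_phi1 V \<theta> E 1 = - cos \<theta>"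
    unfolding disc_phi1_def by auto
qed

text \<open>One step of the recursion acts on pairs of consecutive values by a matrix of determinant
  1.\<close>

lemma disc_wronskian_const:
  assumes f: "disc_solution V E f" and g: "disc_solution V E g"
  shows "crossp (f n, f (Suc n)) (g n, g (Suc n)) = crossp (f 0, f 1) (g 0, g 1)"
  by (induction n)
     (simp_all add: crossp_def disc_solution_step[OF f] disc_solution_step[OF g] algebra_simps)

text \<open>The bilinear form behind \<open>disc_norm\<close>, with the same fractional end term; it
  supplies the mixed term for \<open>sqrt_quadratic_form_le\<close>.\<close>

definition disc_inner :: "(nat \<Rightarrow> real) \<Rightarrow> (nat \<Rightarrow> real) \<Rightarrow> real \<Rightarrow> real" where
  "disc_inner f g L =
     (\<Sum>n = 1..nat \<lfloor>L\<rfloor>. f n * g n) + frac L * (f (nat \<lfloor>L\<rfloor> + 1) * g (nat \<lfloor>L\<rfloor> + 1))"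

lemma disc_norm_eq: "disc_norm f L = sqrt (disc_inner f f L)"
  by (simp add: disc_norm_def disc_inner_def frac_def power2_eq_square)

lemma disc_inner_nonneg: "0 \<le> disc_inner f f L"
  by (simp add: disc_inner_def sum_nonneg)

lemma disc_norm_nonneg: "0 \<le> disc_norm f L"
  by (simp add: disc_norm_eq disc_inner_nonneg)

lemma disc_norm_sq: "(disc_norm f L)\<^sup>2 = disc_inner f f L"
  by (simp add: disc_norm_eq disc_inner_nonneg)

lemma disc_norm_combine:
  "disc_norm (\<lambda>n. a * f n + b * g n) L \<le> \<bar>a\<bar> * disc_norm f L + \<bar>b\<bar> * disc_norm g L"
proof -
  have eq: "disc_inner (\<lambda>n. a * f n + b * g n) (\<lambda>n. a * f n + b * g n) L
      = a\<^sup>2 * disc_inner f f L + 2 * a * b * disc_inner f g L + b\<^sup>2 * disc_inner g g L" for a b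
    by (simp add: disc_inner_def algebra_simps power2_eq_square sum.distrib sum_distrib_left)
  have "0 \<le> a\<^sup>2 * disc_inner f f L + 2 * a * b * disc_inner f g L + b\<^sup>2 * disc_inner g g L" for a b
    unfolding eq[symmetric] by (rule disc_inner_nonneg)
  from sqrt_quadratic_form_le[OF this] show ?thesis
    unfolding disc_norm_eq eq .
qed

text \<open>The weights on the right are monotone in \<open>L\<close>, which makes the norms monotone.\<close>

lemma disc_inner_eq_sum:
  assumes L: "0 \<le> L" and N: "Suc (nat \<lfloor>L\<rfloor>) \<le> N"
  shows "disc_inner f g L = (\<Sum>n = 1..N. max 0 (min 1 (L - real n + 1)) * (f n * g n))"
  using N
proof (induction N rule: dec_induct)
  case base
  let ?m = "nat \<lfloor>L\<rfloor>"
  have m: "real ?m \<le> L" "L < real ?m + 1" "frac L = L - real ?m"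
    using L by (auto simp: frac_def)
  \<comment> \<open>The weight of n is the length of the part of [n - 1, n] below L: it is 1 up to
    the integer part, \<open>frac L\<close> at the next index and 0 afterwards.\<close>
  have "(\<Sum>n = 1..?m. max 0 (min 1 (L - real n + 1)) * (f n * g n)) = (\<Sum>n = 1..?m. f n * g n)"
    by (rule sum.cong) (use m in auto)
  moreover have "max 0 (min 1 (L - real (Suc ?m) + 1)) = frac L" using m by linarith
  ultimately show ?case by (simp add: disc_inner_def)
next
  case (step N)
  then have "L < real N" using L by linarith
  then show ?case using step.IH by simp
qed

lemma disc_norm_mono:
  assumes "0 \<le> L" "L \<le> M"
  shows "disc_norm f L \<le> disc_norm f M"
proof -
  \<comment> \<open>A common range of summation, long enough for the larger argument, allows a
    termwise comparison.\<close>
  let ?N = "Suc (nat \<lfloor>M\<rfloor>)"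
  have "nat \<lfloor>L\<rfloor> \<le> nat \<lfloor>M\<rfloor>" using assms by (intro nat_mono floor_mono)
  then have "disc_inner f f L = (\<Sum>n = 1..?N. max 0 (min 1 (L - real n + 1)) * (f n * f n))"
    using assms by (intro disc_inner_eq_sum) auto
  also have "\<dots> \<le> (\<Sum>n = 1..?N. max 0 (min 1 (M - real n + 1)) * (f n * f n))"
    using assms by (intro sum_mono mult_right_mono) auto
  also have "\<dots> = disc_inner f f M"
    using assms by (intro disc_inner_eq_sum[symmetric]) auto
  finally show ?thesis by (simp add: disc_norm_eq)
qed

lemma disc_norm_eventually_equal:
  assumes eq: "\<And>n. R \<le> n \<Longrightarrow> f n = g n"
  shows "\<exists>C. \<forall>\<^sub>F L in at_top. \<bar>disc_norm f L - disc_norm g L\<bar> \<le> C"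
proof
  let ?h = "\<lambda>n. f n - g n"
  show "\<forall>\<^sub>F L in at_top. \<bar>disc_norm f L - disc_norm g L\<bar> \<le> disc_norm ?h (real R)"
    using eventually_ge_at_top[of "real R"]
  proof eventually_elim
    case (elim L)
    then have R: "R \<le> nat \<lfloor>L\<rfloor>" by (simp add: le_nat_floor)
    have "(\<Sum>n = 1..nat \<lfloor>L\<rfloor>. ?h n * ?h n) = (\<Sum>n = 1..R. ?h n * ?h n)"
      by (rule sum.mono_neutral_right) (use R eq in auto)
    \<comment> \<open>The fractional end term has an index beyond R, where the difference
      vanishes.\<close>
    then have "disc_norm ?h L = disc_norm ?h (real R)"
      using R by (simp add: disc_norm_eq disc_inner_def eq)
    moreover have "disc_norm f L \<le> disc_norm g L + disc_norm ?h L"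
      using disc_norm_combine[of 1 g 1 ?h L] by simp
    moreover have "disc_norm g L \<le> disc_norm f L + disc_norm ?h L"
      using disc_norm_combine[of 1 f "- 1" ?h L] by simp
    ultimately show ?case by simp
  qed
qed

lemma disc_L2_iff: "disc_L2 f \<longleftrightarrow> (\<exists>C. \<forall>L\<ge>0. disc_norm f L \<le> C)"
proof
  assume "disc_L2 f"
  then have sum: "(\<lambda>n. \<bar>f n\<bar>\<^sup>2) summable_on {1..}" by (simp add: disc_L2_def)
  have "disc_norm f L \<le> sqrt (\<Sum>\<^sub>\<infinity>n\<in>{1..}. \<bar>f n\<bar>\<^sup>2)" if "0 \<le> L" for L
  proof -
    \<comment> \<open>Rounding up to an integer removes the fractional term.\<close>
    have "disc_norm f L \<le> disc_norm f (real (nat \<lceil>L\<rceil>))"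
      by (rule disc_norm_mono[OF that]) linarith
    also have "\<dots> = sqrt (\<Sum>n = 1..nat \<lceil>L\<rceil>. \<bar>f n\<bar>\<^sup>2)"
      by (simp add: disc_norm_eq disc_inner_def power2_eq_square)
    also have "\<dots> \<le> sqrt (\<Sum>\<^sub>\<infinity>n\<in>{1..}. \<bar>f n\<bar>\<^sup>2)"
      unfolding real_sqrt_le_iff by (rule finite_sum_le_infsum[OF sum]) auto
    finally show ?thesis .
  qed
  then show "\<exists>C. \<forall>L\<ge>0. disc_norm f L \<le> C" by blast
next
  assume "\<exists>C. \<forall>L\<ge>0. disc_norm f L \<le> C"
  then obtain C where C: "\<And>L. 0 \<le> L \<Longrightarrow> disc_norm f L \<le> C" by blast
  show "disc_L2 f"
    unfolding disc_L2_def
  proof (rule nonneg_bdd_above_summable_on)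
    have "(\<Sum>n\<in>F. \<bar>f n\<bar>\<^sup>2) \<le> C\<^sup>2" if F: "F \<subseteq> {1..}" "finite F" for F
    proof -
      obtain m where "F \<subseteq> {..m}" using F(2) finite_nat_iff_bounded_le by blast
      then have "(\<Sum>n\<in>F. \<bar>f n\<bar>\<^sup>2) \<le> (\<Sum>n = 1..m. \<bar>f n\<bar>\<^sup>2)"
        using F by (intro sum_mono2) auto
      also have "\<dots> = (disc_norm f (real m))\<^sup>2"
        unfolding disc_norm_sq by (simp add: disc_inner_def power2_eq_square)
      also have "\<dots> \<le> C\<^sup>2" using C disc_norm_nonneg by (intro power_mono) auto
      finally show ?thesis .
    qed
    then show "bdd_above (sum (\<lambda>n. \<bar>f n\<bar>\<^sup>2) ` {F. F \<subseteq> {1..} \<and> finite F})"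
      by (intro bdd_aboveI[of _ "C\<^sup>2"]) auto
  qed simp
qed

lemma disc_norms_of_solutions:
  assumes eq: "\<And>n. R < n \<Longrightarrow> V n = V0 n"
  shows "\<exists>e1 e2. norms_of_solutions
    (\<lambda>v. disc_norm (\<lambda>n. fst v * disc_phi1 V0 (pi / 2) E n + snd v * disc_phi1 V0 0 E n)) e1 e2
    (\<lambda>t. disc_norm (disc_phi1 V t E))"
proof -
  let ?n = "\<lambda>v. disc_norm (\<lambda>n. fst v * disc_phi1 V0 (pi / 2) E n + snd v * disc_phi1 V0 0 E n)"
  define f where "f = disc_phi1 V0 (pi / 2) E"
  define g where "g = disc_phi1 V0 0 E"
  define F where "F = disc_phi1 V (pi / 2) E"
  define G where "G = disc_phi1 V 0 E"
  have f: "disc_solution V0 E f" "f 0 = 1" "f 1 = 0"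
    unfolding f_def using disc_phi1_solution[where V = V0 and E = E and \<theta> = "pi / 2"] by auto
  have g: "disc_solution V0 E g" "g 0 = 0" "g 1 = - 1"
    unfolding g_def using disc_phi1_solution[where V = V0 and E = E and \<theta> = 0] by auto
  have F: "disc_solution V E F" "F 0 = 1" "F 1 = 0"
    unfolding F_def using disc_phi1_solution[where V = V and E = E and \<theta> = "pi / 2"] by auto
  have G: "disc_solution V E G" "G 0 = 0" "G 1 = - 1"
    unfolding G_def using disc_phi1_solution[where V = V and E = E and \<theta> = 0] by auto
  have W0: "crossp (f R, f (Suc R)) (g R, g (Suc R)) \<noteq> 0"
    unfolding disc_wronskian_const[OF f(1) g(1)] by (simp only: f g crossp_def) simp
  have W: "crossp (F R, F (Suc R)) (G R, G (Suc R)) \<noteq> 0"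
    unfolding disc_wronskian_const[OF F(1) G(1)] by (simp only: F G crossp_def) simp
  obtain a b where ab: "(F R, F (Suc R)) = a *\<^sub>R (f R, f (Suc R)) + b *\<^sub>R (g R, g (Suc R))"
    using crossp_decompose[OF W0] by blast
  obtain c d where cd: "(G R, G (Suc R)) = c *\<^sub>R (f R, f (Suc R)) + d *\<^sub>R (g R, g (Suc R))"
    using crossp_decompose[OF W0] by blast
  have Ftail: "F x = a * f x + b * g x" and Gtail: "G x = c * f x + d * g x" if "R \<le> x" for x
    using disc_solutions_eq_from[OF F(1) f(1) g(1) eq ab that]
      disc_solutions_eq_from[OF G(1) f(1) g(1) eq cd that] by auto
  have lin: "disc_phi1 V t E n = sin t * F n + cos t * G n" for t n
    using disc_solutions_eq_from[OF disc_phi1_solution(1)[where V = V and E = E and \<theta> = t] F(1) G(1) refl, of 0 "sin t" "cos t"]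
      disc_phi1_solution(2,3)[where V = V and E = E and \<theta> = t] F G by auto
  have "norms_of_solutions ?n (a, b) (c, d) (\<lambda>t. disc_norm (disc_phi1 V t E))"
    unfolding f_def[symmetric] g_def[symmetric]
  proof
    fix L :: real and v w :: "real \<times> real" and r s :: real
    show "0 \<le> disc_norm (\<lambda>x. fst v * f x + snd v * g x) L" by (rule disc_norm_nonneg)
    show "disc_norm (\<lambda>x. fst (r *\<^sub>R v + s *\<^sub>R w) * f x + snd (r *\<^sub>R v + s *\<^sub>R w) * g x) L
        \<le> \<bar>r\<bar> * disc_norm (\<lambda>x. fst v * f x + snd v * g x) L + \<bar>s\<bar> * disc_norm (\<lambda>x. fst w * f x + snd w * g x) L"
      using disc_norm_combine[of r "\<lambda>x. fst v * f x + snd v * g x" s "\<lambda>x. fst w * f x + snd w * g x" L]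
      by (simp add: algebra_simps)
  next
    have "crossp (F R, F (Suc R)) (G R, G (Suc R)) = crossp (a, b) (c, d) * crossp (f R, f (Suc R)) (g R, g (Suc R))"
      using ab cd by (simp add: crossp_def algebra_simps)
    then show "crossp (a, b) (c, d) \<noteq> 0" using W by auto
  next
    fix t
    show "\<exists>C. \<forall>\<^sub>F L in at_top. \<bar>disc_norm (disc_phi1 V t E) L -
        disc_norm (\<lambda>x. fst (sin t *\<^sub>R (a, b) + cos t *\<^sub>R (c, d)) * f x +
          snd (sin t *\<^sub>R (a, b) + cos t *\<^sub>R (c, d)) * g x) L\<bar> \<le> C"
      by (rule disc_norm_eventually_equal[of R]) (simp add: lin Ftail Gtail algebra_simps)
  next
    fix t L :: real
    show "0 \<le> disc_norm (disc_phi1 V t E) L" by (rule disc_norm_nonneg)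
  next
    fix t L M :: real
    assume "0 \<le> L" "L \<le> M"
    then show "disc_norm (disc_phi1 V t E) L \<le> disc_norm (disc_phi1 V t E) M"
      by (rule disc_norm_mono)
  next
    fix t
    let ?u = "disc_phi1 V t E"
    \<comment> \<open>The norm does not see the value at 0, and the value at 1 alone may vanish. If
      the values at 1 and 2 both vanish, the recursion also gives 0 at index 0, against sin^2 +
      cos^2 = 1.\<close>
    have "disc_norm ?u 2 \<noteq> 0"
    proof
      assume "disc_norm ?u 2 = 0"
      then have "?u 1 * ?u 1 + ?u 2 * ?u 2 = 0"
        by (simp add: disc_norm_eq disc_inner_def frac_def numeral_2_eq_2)
      then have "?u 1 = 0" "?u 2 = 0" by (simp_all add: sum_squares_eq_zero_iff)
      then have "?u 0 = 0"
        using disc_solution_step[OF disc_phi1_solution(1)[where V = V and E = E and \<theta> = t], of 0] by (simp add: numeral_2_eq_2)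
      with \<open>?u 1 = 0\<close> show False
        using disc_phi1_solution(2,3)[where V = V and E = E and \<theta> = t] sin_cos_squared_add[of t] by simp
    qed
    then show "\<exists>L\<ge>0. 0 < disc_norm ?u L"
      using disc_norm_nonneg[of ?u 2] by (intro exI[of _ 2]) auto
  qed
  then show ?thesis unfolding f_def g_def by blast
qed

lemma disc_S_beta_transfer:
  assumes eq: "\<And>n. R < n \<Longrightarrow> V n = V0 n"
  shows "E \<in> disc_S V \<longleftrightarrow> E \<in> disc_S V0"
    and "E \<in> disc_S V0 \<Longrightarrow> disc_beta E V = disc_beta E V0"
proof -
  let ?n = "\<lambda>v. disc_norm (\<lambda>n. fst v * disc_phi1 V0 (pi / 2) E n + snd v * disc_phi1 V0 0 E n)"
  obtain e1 e2 where e: "norms_of_solutions ?n e1 e2 (\<lambda>t. disc_norm (disc_phi1 V t E))"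
    using disc_norms_of_solutions[of R V V0 E] eq by blast
  obtain d1 d2 where d: "norms_of_solutions ?n d1 d2 (\<lambda>t. disc_norm (disc_phi1 V0 t E))"
    using disc_norms_of_solutions[of 0 V0 V0 E] by blast
  have S: "E \<in> disc_S U \<longleftrightarrow> norms_of_solutions.S_cond (\<lambda>t. disc_norm (disc_phi1 U t E))"
    and beta: "disc_beta E U = norms_of_solutions.beta (\<lambda>t. disc_norm (disc_phi1 U t E))"
    if n: "norms_of_solutions ?n c1 c2 (\<lambda>t. disc_norm (disc_phi1 U t E))" for U c1 c2
  proof -
    interpret norms_of_solutions ?n c1 c2 "\<lambda>t. disc_norm (disc_phi1 U t E)" by (fact n)
    have th: "disc_theta U E = theta"
      by (simp add: theta_def disc_theta_def disc_subordinate_def disc_phi2_def)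
    show "E \<in> disc_S U \<longleftrightarrow> S_cond"
      by (simp add: disc_S_def S_cond_def th disc_subordinate_def disc_phi2_def disc_L2_iff)
    show "disc_beta E U = beta"
      by (simp add: disc_beta_def beta_def th disc_phi2_def)
  qed
  show "E \<in> disc_S V \<longleftrightarrow> E \<in> disc_S V0"
    unfolding S[OF e] S[OF d] by (rule S_beta_transfer(1)[OF e d])
  show "disc_beta E V = disc_beta E V0" if "E \<in> disc_S V0"
    using S_beta_transfer(2)[OF e d] that unfolding S[OF d] beta[OF e] beta[OF d] .
qed

lemma disc_compact_perturbation:
  assumes W: "disc_compact_support W" and V: "\<And>n. 1 \<le> n \<Longrightarrow> V n = V0 n + W n"
  shows "disc_S V = disc_S V0" and "E \<in> disc_S V0 \<Longrightarrow> disc_beta E V = disc_beta E V0"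
proof -
  obtain R where R: "{n. 1 \<le> n \<and> W n \<noteq> 0} \<subseteq> {..R}"
    using W finite_nat_iff_bounded_le unfolding disc_compact_support_def by blast
  have eq: "V n = V0 n" if "R < n" for n
  proof -
    have "1 \<le> n" "n \<notin> {..R}" using that by auto
    moreover have "W n = 0" using calculation R by blast
    ultimately show ?thesis using V[of n] by simp
  qed
  show "disc_S V = disc_S V0" using disc_S_beta_transfer(1)[of R V V0] eq by blast
  show "E \<in> disc_S V0 \<Longrightarrow> disc_beta E V = disc_beta E V0"
    using disc_S_beta_transfer(2)[of R V V0] eq by blast
qed

theorem theorem1p5:
  shows "(\<forall>V V0 W :: real \<Rightarrow> real.
            cont_potential V0 \<and> cont_potential W \<and> cont_compact_support W \<and>
            (\<forall>x\<ge>0. V x = V0 x + W x) \<longrightarrow>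
            cont_S V = cont_S V0 \<and> (\<forall>E\<in>cont_S V0. cont_beta E V = cont_beta E V0))
       \<and> (\<forall>V V0 W :: nat \<Rightarrow> real.
            disc_compact_support W \<and> (\<forall>n\<ge>1. V n = V0 n + W n) \<longrightarrow>
            disc_S V = disc_S V0 \<and> (\<forall>E\<in>disc_S V0. disc_beta E V = disc_beta E V0))"
proof (intro conjI allI impI ballI)
  fix V V0 W :: "real \<Rightarrow> real"
  assume "cont_potential V0 \<and> cont_potential W \<and> cont_compact_support W \<and> (\<forall>x\<ge>0. V x = V0 x + W x)"
  then have *: "cont_potential V0" "cont_potential W" "cont_compact_support W"
    "\<And>x. 0 \<le> x \<Longrightarrow> V x = V0 x + W x" by auto
  show "cont_S V = cont_S V0" by (rule cont_compact_perturbation(1)[OF *])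
  show "cont_beta E V = cont_beta E V0" if "E \<in> cont_S V0" for E
    by (rule cont_compact_perturbation(2)[OF * that])
next
  fix V V0 W :: "nat \<Rightarrow> real"
  assume "disc_compact_support W \<and> (\<forall>n\<ge>1. V n = V0 n + W n)"
  then have *: "disc_compact_support W" "\<And>n. 1 \<le> n \<Longrightarrow> V n = V0 n + W n" by auto
  show "disc_S V = disc_S V0" by (rule disc_compact_perturbation(1)[OF *])
  show "disc_beta E V = disc_beta E V0" if "E \<in> disc_S V0" for E
    by (rule disc_compact_perturbation(2)[OF * that])
qed

end
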